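(* Let $\Gamma$ be a logarithmically divergent connected graph with $n\ge 1$ loops and $2n$ edges. The period $$P(\Gamma)=\int_{\mathbb{P}^{4n-1}(\mathbb{R})}\frac{\Omega_{4n-1}(Z)}{q_1\cdots q_{2n}}$$ converges if and only if every nonempty proper subgraph $G\subsetneq\Gamma$ is convergent, i.e. if and only if $\Gamma$ is primitive log divergent.
   Context: Graphs are finite; subgraphs are identified with their edge sets (no isolated vertices) and need not be connected. The number of loops of a graph is its first Betti number $h_1$. A graph with $N$ edges and $m$ loops is convergent if $N>2m$ and logarithmically divergent if $N=2m$. A connected graph is primitive log divergent if it is logarithmically divergent and every nonempty connected proper subgraph is convergent (has strictly more edges than twice its first Betti number). Orient the edges; $H=H_1(\Gamma,\mathbb{Q})\subset\mathbb{Q}[E]$ is the kernel of the boundary map $\mathbb{Q}[E]\to\mathbb{Q}[V]$, of dimension $n$, and $\ell_i:H\to\mathbb{Q}$ is the restriction of the coordinate functional $e_i^\vee$ of the $i$-th edge. The Feynman quadric is the quadratic form $q_i(z_1,z_2,z_3,z_4)=\sum_{a=1}^4\ell_i(z_a)^2$ on $H^4\cong\mathbb{Q}^{4n}$, with linear coordinates $Z_1,\dots,Z_{4n}$ and $\mathbb{P}^{4n-1}=\mathbb{P}(H^4)$. $\Omega_{4n-1}(Z)=\sum_{i}(-1)^iZ_i\,dZ_1\wedge\cdots\widehat{dZ_i}\cdots\wedge dZ_{4n}$. The integrand is of constant sign (for an orientation of $\mathbb{P}^{4n-1}(\mathbb{R})$) and convergence means finiteness of the integral; if some $\ell_i=0$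 the integral is considered divergent. *)

theory Defs
  imports
    "HOL-Analysis.Analysis"
    "HOL-Library.Function_Algebras"
    "Graph_Theory.Digraph_Component"
    "Jordan_Normal_Form.Determinant"
begin

text \<open>
  An oriented finite multigraph (self-loops and parallel edges allowed) is a record
  \<^typ>\<open>('v, 'e) pre_digraph\<close> satisfying \<^locale>\<open>fin_digraph\<close>; the direction of the arcs is the chosen
  orientation.  Connectedness is that of the underlying undirected graph
  (\<^const>\<open>Digraph_Component.connected\<close>).
\<close>

section \<open>Cycle space and loop number\<close>

text \<open>\<open>\<rat>[X]\<close> is modelled by functions \<open>X \<Rightarrow> rat\<close>.\<close>

definition chain_scale :: "rat \<Rightarrow> ('e \<Rightarrow> rat) \<Rightarrow> 'e \<Rightarrow> rat" where
  "chain_scale r c = (\<lambda>e. r * c e)"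

definition tuple_scale :: "rat \<Rightarrow> (4 \<Rightarrow> 'e \<Rightarrow> rat) \<Rightarrow> 4 \<Rightarrow> 'e \<Rightarrow> rat" where
  "tuple_scale r z = (\<lambda>a. chain_scale r (z a))"

global_interpretation chain: vector_space "chain_scale :: rat \<Rightarrow> ('e \<Rightarrow> rat) \<Rightarrow> _"
  by unfold_locales (auto simp: chain_scale_def fun_eq_iff algebra_simps)

global_interpretation tuple: vector_space "tuple_scale :: rat \<Rightarrow> (4 \<Rightarrow> 'e \<Rightarrow> rat) \<Rightarrow> _"
  by unfold_locales (auto simp: tuple_scale_def chain_scale_def fun_eq_iff algebra_simps)

definition boundary :: "('v, 'e) pre_digraph \<Rightarrow> ('e \<Rightarrow> rat) \<Rightarrow> 'v \<Rightarrow> rat" where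
  "boundary G c v = (\<Sum>e\<in>in_arcs G v. c e) - (\<Sum>e\<in>out_arcs G v. c e)"

definition H1 :: "('v, 'e) pre_digraph \<Rightarrow> ('e \<Rightarrow> rat) set" where
  "H1 G = {c. (\<forall>e. e \<notin> arcs G \<longrightarrow> c e = 0) \<and> (\<forall>v\<in>verts G. boundary G c v = 0)}"

definition loop_number :: "('v, 'e) pre_digraph \<Rightarrow> nat" where
  "loop_number G = chain.dim (H1 G)"

section \<open>Subgraphs and divergence\<close>

definition edge_subgraph :: "('v, 'e) pre_digraph \<Rightarrow> 'e set \<Rightarrow> ('v, 'e) pre_digraph" where
  "edge_subgraph G A =
    \<lparr>verts = tail G ` A \<union> head G ` A, arcs = A, tail = tail G, head = head G\<rparr>"

definition convergent_graph :: "('v, 'e) pre_digraph \<Rightarrow> bool" where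
  "convergent_graph G \<longleftrightarrow> card (arcs G) > 2 * loop_number G"

definition log_divergent :: "('v, 'e) pre_digraph \<Rightarrow> bool" where
  "log_divergent G \<longleftrightarrow> card (arcs G) = 2 * loop_number G"

definition primitive_log_divergent :: "('v, 'e) pre_digraph \<Rightarrow> bool" where
  "primitive_log_divergent G \<longleftrightarrow>
     Digraph_Component.connected G \<and> log_divergent G \<and>
     (\<forall>A. A \<noteq> {} \<and> A \<subset> arcs G \<and> Digraph_Component.connected (edge_subgraph G A)
        \<longrightarrow> convergent_graph (edge_subgraph G A))"

section \<open>Feynman quadrics\<close>

text \<open>The space \<open>H\<^sup>4\<close> and the data of linear coordinates \<open>Z\<^sub>1, \<dots>, Z\<^sub>N\<close> on it, given by the
  basis \<open>B 1, \<dots>, B N\<close> to which they are dual.\<close>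

definition H1_4 :: "('v, 'e) pre_digraph \<Rightarrow> (4 \<Rightarrow> 'e \<Rightarrow> rat) set" where
  "H1_4 G = {z. \<forall>a. z a \<in> H1 G}"

definition linear_coordinates ::
    "('v, 'e) pre_digraph \<Rightarrow> nat \<Rightarrow> (nat \<Rightarrow> 4 \<Rightarrow> 'e \<Rightarrow> rat) \<Rightarrow> bool" where
  "linear_coordinates G N B \<longleftrightarrow>
     inj_on B {1..N} \<and> tuple.independent (B ` {1..N}) \<and> tuple.span (B ` {1..N}) = H1_4 G"

text \<open>The point of \<open>(H \<otimes> \<real>)\<^sup>4\<close> with real coordinates \<open>Z\<close>.\<close>

definition real_point :: "nat \<Rightarrow> (nat \<Rightarrow> 4 \<Rightarrow> 'e \<Rightarrow> rat) \<Rightarrow> (nat \<Rightarrow> real) \<Rightarrow> 4 \<Rightarrow> 'e \<Rightarrow> real" where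
  "real_point N B Z = (\<lambda>a e. \<Sum>k=1..N. Z k * of_rat (B k a e))"

definition edge_functional :: "'e \<Rightarrow> ('e \<Rightarrow> real) \<Rightarrow> real" where
  "edge_functional e c = c e"

definition feynman_quadric :: "'e \<Rightarrow> (4 \<Rightarrow> 'e \<Rightarrow> real) \<Rightarrow> real" where
  "feynman_quadric e z = (\<Sum>a\<in>UNIV. (edge_functional e (z a))\<^sup>2)"

section \<open>Integration over real projective space\<close>

text \<open>\<open>(dZ\<^bsub>k\<^sub>1\<^esub> \<and> \<dots> \<and> dZ\<^bsub>k\<^sub>m\<^esub>)(v\<^sub>0, \<dots>, v\<^bsub>m-1\<^esub>)\<close> for \<open>ks = [k\<^sub>1, \<dots>, k\<^sub>m]\<close>.\<close>

definition wedge_dZ :: "nat list \<Rightarrow> (nat \<Rightarrow> nat \<Rightarrow> real) \<Rightarrow> real" where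
  "wedge_dZ ks v = Determinant.det
     (Matrix.mat (length ks) (length ks) (\<lambda>(r, c). v c (ks ! r)))"

text \<open>The form \<open>\<Omega>\<^bsub>N-1\<^esub>\<close> in the coordinates \<open>Z\<^sub>1, \<dots>, Z\<^sub>N\<close>, at the point \<open>Z\<close>, evaluated on
  tangent vectors \<open>v 0, \<dots>, v (N - 2)\<close>.\<close>

definition Omega :: "nat \<Rightarrow> (nat \<Rightarrow> real) \<Rightarrow> (nat \<Rightarrow> nat \<Rightarrow> real) \<Rightarrow> real" where
  "Omega N Z v = (\<Sum>i=1..N. (-1) ^ i * Z i * wedge_dZ (filter (\<lambda>k. k \<noteq> i) [1..<Suc N]) v)"

text \<open>
  For \<open>f \<ge> 0\<close> homogeneous of degree \<open>-N\<close>, the integral of \<open>f \<Omega>\<^bsub>N-1\<^esub>\<close> over \<open>\<P>\<^bsup>N-1\<^esup>(\<real>)\<close>, the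
  orientation being chosen so that the integrand is nonnegative.  It is computed in the affine
  chart \<open>Z\<^sub>1 = 1\<close> with coordinates \<open>x\<^sub>2, \<dots>, x\<^sub>N\<close>, whose complement is a null set: the form is
  pulled back along \<open>x \<mapsto> x(1 := 1)\<close>, which sends \<open>\<partial>/\<partial>x\<^sub>k\<close> to the \<open>k\<close>-th unit vector.
\<close>

definition proj_integral :: "nat \<Rightarrow> ((nat \<Rightarrow> real) \<Rightarrow> ennreal) \<Rightarrow> ennreal" where
  "proj_integral N f =
     (\<integral>\<^sup>+ x. f (x(1 := 1)) *
        ennreal \<bar>Omega N (x(1 := 1)) (\<lambda>c k. if k = c + 2 then 1 else 0)\<bar>
      \<partial>(\<Pi>\<^sub>M k\<in>{2..N}. lborel))"

text \<open>
  In \<^typ>\<open>ennreal\<close>, \<open>1 / 0 = \<infinity>\<close>.  Hence the zero locus of the denominator contributes nothing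
  when it is a null set, and the period is \<open>\<infinity>\<close> as soon as one of the functionals \<open>\<ell>\<^sub>i\<close>
  vanishes identically on \<open>H\<close>, in accordance with the convention that the period then diverges.
\<close>

definition period :: "('v, 'e) pre_digraph \<Rightarrow> nat \<Rightarrow> (nat \<Rightarrow> 4 \<Rightarrow> 'e \<Rightarrow> rat) \<Rightarrow> ennreal" where
  "period G N B =
     proj_integral N (\<lambda>Z. 1 / ennreal (\<Prod>e\<in>arcs G. feynman_quadric e (real_point N B Z)))"

definition period_converges :: "('v, 'e) pre_digraph \<Rightarrow> nat \<Rightarrow> (nat \<Rightarrow> 4 \<Rightarrow> 'e \<Rightarrow> rat) \<Rightarrow> bool" where
  "period_converges G N B \<longleftrightarrow> period G N B < \<infinity>"

end

theory Submission
  imports Defs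
begin

text \<open>
  For a set \<open>F\<close> of edges let \<open>r(F)\<close> be the rank of the functionals \<open>\<ell>\<^sub>e\<close>, \<open>e \<in> F\<close>.  The subgraph
  complementary to \<open>F\<close> is convergent iff \<open>card F < 2 r(F)\<close>.

  Convergence: at a point with \<open>max \<bar>\<ell>\<^sub>e\<bar>\<close> of order \<open>1\<close>, a basis \<open>b\<close> chosen greedily among the
  edges with smallest \<open>\<bar>\<ell>\<^sub>e\<bar>\<close> satisfies
  \<open>\<Prod>\<^sub>e \<bar>\<ell>\<^sub>e\<bar>\<^sup>-\<^sup>2 \<le> const \<cdot> \<Prod>\<^sub>e\<^sub>\<in>\<^sub>b \<bar>\<ell>\<^sub>e\<bar>\<^sup>-\<^sup>s\<close> with \<open>s = 4 - 2/n < 4\<close>, because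
  \<open>card F \<le> (2 - 1/n) r(F)\<close> for all \<open>F\<close> but the full edge set.  Taking \<open>(\<ell>\<^sub>e)\<close>, \<open>e \<in> b\<close>, as coordinates,
  the right-hand side is a product of functions integrable at the origin of \<open>\<real>\<^sup>4\<close>.

  Divergence: if \<open>card F \<ge> 2 r(F)\<close>, then on dyadic shells around the locus \<open>\<ell>\<^sub>e = 0\<close>, \<open>e \<in> F\<close>, the
  integrand grows at least as fast as the inverse of the volume, so every shell contributes at least
  a fixed positive amount.
\<close>

section \<open>Bases of edge functionals\<close>

text \<open>For \<open>H\<close> the cycle space of a graph this is the cycle space of the subgraph
  left after deleting \<open>F\<close>; its codimension in \<open>H\<close> is the rank of the
  functionals indexed by \<open>F\<close>.\<close>

definition vanishing :: "('e \<Rightarrow> rat) set \<Rightarrow> 'e set \<Rightarrow> ('e \<Rightarrow> rat) set" where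
  "vanishing H F = {c \<in> H. \<forall>e\<in>F. c e = 0}"

lemma vanishing_insert: "vanishing H (insert e F) = vanishing (vanishing H F) {e}"
  by (auto simp: vanishing_def)

lemma vanishing_empty [simp]: "vanishing H {} = H"
  by (simp add: vanishing_def)

lemma subspace_vanishing:
  assumes "chain.subspace H"
  shows "chain.subspace (vanishing H F)"
  using assms by (auto simp: vanishing_def chain.subspace_def chain_scale_def)

lemma span_vanishing_subset: "H \<subseteq> chain.span S \<Longrightarrow> vanishing H F \<subseteq> chain.span S"
  by (auto simp: vanishing_def)

text \<open>The kernel of a nonzero functional is a hyperplane: each \<open>c\<close> differs from a
  multiple of \<open>v\<close> by a kernel element, so \<open>v\<close> completes a basis of the
  kernel. The finite spanning set keeps \<open>dim\<close> meaningful.\<close>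

lemma dim_vanishing_single:
  assumes H: "chain.subspace H" "finite S" "H \<subseteq> chain.span S"
    and v: "v \<in> H" "v e \<noteq> 0"
  shows "chain.dim H = chain.dim (vanishing H {e}) + 1"
proof -
  let ?K = "vanishing H {e}"
  obtain B where B: "B \<subseteq> ?K" "chain.independent B" "?K \<subseteq> chain.span B" "card B = chain.dim ?K"
    using chain.basis_exists by blast
  have fin: "finite B"
    using chain.independent_span_bound[OF assms(2) B(2)] B(1) H(3) by (auto simp: vanishing_def)
  have span: "chain.span B \<subseteq> ?K"
    using B(1) subspace_vanishing[OF H(1)] by (rule chain.span_minimal)
  have v': "v \<notin> chain.span B"
    using span v by (auto simp: vanishing_def)
  have "H \<subseteq> chain.span (insert v B)"
  proof
    fix c assume c: "c \<in> H"
    have "c - chain_scale (c e / v e) v \<in> ?K"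
      using c v H(1) by (simp add: vanishing_def chain.subspace_diff chain.subspace_scale)
        (simp add: chain_scale_def)
    then show "c \<in> chain.span (insert v B)"
      using B(3) chain.span_breakdown_eq by blast
  qed
  moreover have "insert v B \<subseteq> H" using v B(1) by (auto simp: vanishing_def)
  moreover have "chain.independent (insert v B)"
    using v' B(2) by (rule chain.independent_insertI)
  ultimately have "chain.dim H = card (insert v B)"
    by (metis chain.basis_card_eq_dim)
  then show ?thesis
    using fin B(4) v' chain.span_base[of v B] by (auto simp: card_insert_if)
qed

text \<open>A maximal independent set in the linear matroid of the edge functionals on
  \<open>H\<close>. Spanning is expressed by equal common kernels, independence by a codimension
  equal to the number of functionals.\<close>

definition edge_basis :: "('e \<Rightarrow> rat) set \<Rightarrow> 'e set \<Rightarrow> 'e set \<Rightarrow> bool" where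
  "edge_basis H B F \<longleftrightarrow> B \<subseteq> F \<and> vanishing H B = vanishing H F \<and>
     card B + chain.dim (vanishing H B) = chain.dim H"

lemma edge_basis_empty: "edge_basis H {} {}"
  by (simp add: edge_basis_def)

text \<open>The functional of \<open>e\<close> either vanishes on the common kernel already, and the
  basis stays, or it cuts that kernel down by exactly one dimension, and \<open>e\<close> joins the
  basis.\<close>

lemma edge_basis_insert:
  assumes H: "chain.subspace H" "finite S" "H \<subseteq> chain.span S"
    and B: "edge_basis H B F" "finite F"
  obtains B' where "B' = B \<or> B' = insert e B \<and> e \<notin> B" "edge_basis H B' (insert e F)"
proof (cases "vanishing H (insert e F) = vanishing H F")
  case True
  then have "edge_basis H B (insert e F)" using B(1) by (auto simp: edge_basis_def)
  then show ?thesis using that by blast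
next
  case False
  then obtain v where v: "v \<in> vanishing H F" "v e \<noteq> 0"
    by (auto simp: vanishing_def)
  have fin: "finite B" using B finite_subset by (auto simp: edge_basis_def)
  have e: "e \<notin> B" using v B by (auto simp: edge_basis_def vanishing_def)
  have "chain.dim (vanishing H F) = chain.dim (vanishing H (insert e F)) + 1"
    unfolding vanishing_insert[of H e F]
    by (rule dim_vanishing_single[OF subspace_vanishing[OF H(1)] H(2) span_vanishing_subset[OF H(3)]])
      (use v in auto)
  moreover have "vanishing H (insert e B) = vanishing H (insert e F)"
    using B unfolding vanishing_insert[of H e F] vanishing_insert[of H e B]
    by (simp add: edge_basis_def)
  ultimately have "edge_basis H (insert e B) (insert e F)"
    using B e fin by (auto simp: edge_basis_def)
  then show ?thesis using e that[of "insert e B"] by auto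
qed

lemma edge_basis_extend:
  assumes H: "chain.subspace H" "finite S" "H \<subseteq> chain.span S"
    and B: "edge_basis H B F" "finite F" "finite G"
  shows "\<exists>B'. B \<subseteq> B' \<and> edge_basis H B' (F \<union> G)"
  using B(3)
proof (induction G)
  case empty
  then show ?case using B by auto
next
  case (insert e G)
  then obtain B' where "B \<subseteq> B'" "edge_basis H B' (F \<union> G)" by auto
  with edge_basis_insert[OF H this(2), of e] insert B(2) show ?case
    by (metis Un_insert_right finite_UnI subset_insertI2)
qed

text \<open>The greedy algorithm: edges are inserted by decreasing weight, and Abel summation compares
  the total weight with the weight of the basis.\<close>

lemma greedy_edge_basis:
  fixes a :: "'e \<Rightarrow> real" and \<kappa> :: real
  assumes H: "chain.subspace H" "finite S" "H \<subseteq> chain.span S"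
    and "finite F"
    and "\<And>F' B. F' \<subseteq> F \<Longrightarrow> edge_basis H B F' \<Longrightarrow> real (card F') \<le> \<kappa> * card B"
  shows "\<exists>B. edge_basis H B F \<and>
    (\<forall>t. (\<forall>e\<in>F. t \<le> a e) \<longrightarrow> (\<Sum>e\<in>F. a e - t) \<le> \<kappa> * (\<Sum>e\<in>B. a e - t))"
  using assms(4,5)
proof (induction F rule: finite_ranking_induct[where f = "\<lambda>e. - a e"])
  case empty
  then show ?case using edge_basis_empty by fastforce
next
  case (insert e F)
  show ?case
  proof (cases "e \<in> F")
    case True
    then show ?thesis using insert by (simp add: insert_absorb)
  next
    case False
    obtain B where B: "edge_basis H B F"
      "\<And>t. (\<forall>x\<in>F. t \<le> a x) \<Longrightarrow> (\<Sum>x\<in>F. a x - t) \<le> \<kappa> * (\<Sum>x\<in>B. a x - t)"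
      using insert by (meson order_trans subset_insertI)
    obtain B' where B': "B' = B \<or> B' = insert e B \<and> e \<notin> B" "edge_basis H B' (insert e F)"
      using edge_basis_insert[OF H B(1) insert(1)] by metis
    have fin: "finite B" using B(1) insert(1) finite_subset by (auto simp: edge_basis_def)
    have "(\<Sum>x\<in>insert e F. a x - t) \<le> \<kappa> * (\<Sum>x\<in>B'. a x - t)"
      if t: "\<forall>x\<in>insert e F. t \<le> a x" for t
    proof -
      \<comment> \<open>Since \<open>e\<close> has the smallest weight, \<open>a e\<close> is an
        admissible threshold for the induction hypothesis, and \<open>e\<close> itself contributes 0
        there. Lowering the threshold to \<open>t\<close> adds multiples of the cardinalities, which
        the rank hypothesis compares.\<close>
      have split: "(\<Sum>x\<in>X. a x - t) = (\<Sum>x\<in>X. a x - a e) + card X * (a e - t)" for X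
        by (simp add: sum_subtractf algebra_simps)
      have "(\<Sum>x\<in>insert e F. a x - a e) = (\<Sum>x\<in>F. a x - a e)"
        using False insert(1) by simp
      also have "\<dots> \<le> \<kappa> * (\<Sum>x\<in>B. a x - a e)"
        using insert(2) by (intro B(2)) auto
      also have "(\<Sum>x\<in>B. a x - a e) = (\<Sum>x\<in>B'. a x - a e)"
        using B'(1) fin by auto
      finally have *: "(\<Sum>x\<in>insert e F. a x - a e) \<le> \<kappa> * (\<Sum>x\<in>B'. a x - a e)" .
      have "real (card (insert e F)) * (a e - t) \<le> \<kappa> * card B' * (a e - t)"
        using insert.prems[OF order_refl B'(2)] t by (intro mult_right_mono) auto
      with * show ?thesis
        unfolding split[of "insert e F"] split[of B'] by (simp add: algebra_simps)
    qed
    then show ?thesis using B'(2) by blast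
  qed
qed

text \<open>A functional that vanishes on the common kernel of finitely many others is a combination
  of them. The induction passes to the hyperplane on which one of them vanishes.\<close>

lemma vanishing_combination:
  assumes "finite B" "chain.subspace H" "\<And>c. c \<in> vanishing H B \<Longrightarrow> c e = 0"
  shows "\<exists>\<gamma>. \<forall>c\<in>H. c e = (\<Sum>b\<in>B. \<gamma> b * c b)"
  using assms
proof (induction B arbitrary: H)
  case empty
  then show ?case by simp
next
  case (insert b B)
  have "\<exists>\<gamma>. \<forall>c\<in>vanishing H {b}. c e = (\<Sum>x\<in>B. \<gamma> x * c x)"
    using insert by (intro insert.IH subspace_vanishing) (auto simp: vanishing_def)
  then obtain \<gamma> where \<gamma>: "\<And>c. c \<in> vanishing H {b} \<Longrightarrow> c e = (\<Sum>x\<in>B. \<gamma> x * c x)"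
    by blast
  show ?case
  proof (cases "\<exists>v\<in>H. v b \<noteq> 0")
    case False
    then have "c e = (\<Sum>x\<in>insert b B. \<gamma> x * c x)" if "c \<in> H" for c
      using \<gamma>[of c] that insert by (simp add: vanishing_def)
    then show ?thesis by blast
  next
    case True
    then obtain v where v: "v \<in> H" "v b \<noteq> 0" by blast
    \<comment> \<open>The coefficient that makes the identity hold at \<open>v\<close>; together
      with the hyperplane, \<open>v\<close> spans \<open>H\<close>.\<close>
    define \<delta> where "\<delta> = (v e - (\<Sum>x\<in>B. \<gamma> x * v x)) / v b"
    have "c e = (\<Sum>x\<in>insert b B. (\<gamma>(b := \<delta>)) x * c x)" if c: "c \<in> H" for c
    proof -
      define r where "r = c b / v b"
      have "c - chain_scale r v \<in> vanishing H {b}"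
        using c v insert.prems(1) unfolding r_def
        by (simp add: vanishing_def chain.subspace_diff chain.subspace_scale)
          (simp add: chain_scale_def)
      from \<gamma>[OF this] have "c e - r * v e = (\<Sum>x\<in>B. \<gamma> x * c x) - r * (\<Sum>x\<in>B. \<gamma> x * v x)"
        by (simp add: chain_scale_def sum_subtractf sum_distrib_left algebra_simps)
      moreover have "(\<Sum>x\<in>B. (\<gamma>(b := \<delta>)) x * c x) = (\<Sum>x\<in>B. \<gamma> x * c x)"
        using insert by (intro sum.cong) auto
      ultimately show ?thesis
        using insert v by (simp add: r_def \<delta>_def field_simps)
    qed
    then show ?thesis by blast
  qed
qed

section \<open>Integration over finite products of lines\<close>

abbreviation lborelP :: "'i set \<Rightarrow> ('i \<Rightarrow> real) measure" where
  "lborelP I \<equiv> \<Pi>\<^sub>M i\<in>I. lborel"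

interpretation lborelP: product_sigma_finite "\<lambda>_. lborel :: real measure"
  by (simp add: product_sigma_finite_def lborel.sigma_finite_measure_axioms)

text \<open>One step of Gaussian elimination with pivot \<^term>\<open>M j0 k\<close>.\<close>

definition pivot :: "('j \<Rightarrow> 'i \<Rightarrow> rat) \<Rightarrow> 'j \<Rightarrow> 'i \<Rightarrow> 'j \<Rightarrow> 'i \<Rightarrow> rat" where
  "pivot M j0 k = (\<lambda>j i. M j i - M j k * M j0 i / M j0 k)"

text \<open>Injectivity over the rationals. For index sets of equal size it is invertibility, stated
  without determinants because rows and columns are indexed by different types.\<close>

definition trivial_kernel :: "('j \<Rightarrow> 'i \<Rightarrow> rat) \<Rightarrow> 'i set \<Rightarrow> 'j set \<Rightarrow> bool" where
  "trivial_kernel M I J \<longleftrightarrow>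
     (\<forall>v. (\<forall>j\<in>J. (\<Sum>i\<in>I. v i * M j i) = 0) \<longrightarrow> (\<forall>i\<in>I. v i = 0))"

lemma trivial_kernel_pivot:
  assumes ker: "trivial_kernel M (insert k I) J" and I: "finite I" "k \<notin> I"
    and j0: "j0 \<in> J" "M j0 k \<noteq> 0"
  shows "trivial_kernel (pivot M j0 k) I (J - {j0})"
  unfolding trivial_kernel_def
proof (intro allI impI)
  fix v :: "'b \<Rightarrow> rat"
  assume v: "\<forall>j\<in>J - {j0}. (\<Sum>i\<in>I. v i * pivot M j0 k j i) = 0"
  \<comment> \<open>The value at \<open>k\<close> solves the pivot row, so a kernel vector of the
    reduced system extends to one of the original system.\<close>
  define v' where "v' = v(k := - (\<Sum>i\<in>I. v i * M j0 i) / M j0 k)"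
  have v'I: "(\<Sum>i\<in>I. v' i * M j i) = (\<Sum>i\<in>I. v i * M j i)" for j
    using I by (intro sum.cong) (auto simp: v'_def)
  have "(\<Sum>i\<in>insert k I. v' i * M j i) = 0" if "j \<in> J" for j
  proof (cases "j = j0")
    case True
    then show ?thesis using I j0(2) by (simp add: v'I) (simp add: v'_def)
  next
    case False
    have "0 = (\<Sum>i\<in>I. v i * pivot M j0 k j i)" using v that False by auto
    also have "\<dots> = (\<Sum>i\<in>I. v i * M j i) - M j k / M j0 k * (\<Sum>i\<in>I. v i * M j0 i)"
      by (simp add: pivot_def sum_subtractf sum_distrib_left algebra_simps)
    finally show ?thesis using I by (simp add: v'I) (simp add: v'_def)
  qed
  then have "\<forall>i\<in>insert k I. v' i = 0"
    using ker by (auto simp: trivial_kernel_def)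
  then show "\<forall>i\<in>I. v i = 0" using I by (auto simp: v'_def split: if_splits)
qed

lemma trivial_kernel_pivot_exists:
  assumes "trivial_kernel M (insert k I) J" "finite I" "k \<notin> I"
  shows "\<exists>j0\<in>J. M j0 k \<noteq> 0"
proof (rule ccontr)
  assume *: "\<not> ?thesis"
  have "(\<Sum>i\<in>insert k I. (if i = k then 1 else 0) * M j i) = 0" if "j \<in> J" for j
    using * that by (intro sum.neutral) auto
  then show False
    using assms(1)[unfolded trivial_kernel_def, rule_format, of "\<lambda>i. if i = k then 1 else 0" k]
    by simp
qed

text \<open>Injectivity passes from rational to real vectors because elimination uses only rational
  pivots and applies verbatim to real unknowns.\<close>

lemma trivial_kernel_real:
  assumes "finite I" "trivial_kernel M I J"
    and "\<And>j. j \<in> J \<Longrightarrow> (\<Sum>i\<in>I. v i * real_of_rat (M j i)) = 0" "i \<in> I"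
  shows "v i = 0"
  using assms
proof (induction I arbitrary: M J i)
  case empty
  then show ?case by simp
next
  case (insert k I)
  obtain j0 where j0: "j0 \<in> J" "M j0 k \<noteq> 0"
    using trivial_kernel_pivot_exists[OF insert(4,1,2)] by blast
  have eq: "(\<Sum>i\<in>I. v i * of_rat (M j i)) = - v k * of_rat (M j k)" if "j \<in> J" for j
    using insert.prems(2)[OF that] insert.hyps by (simp add: eq_neg_iff_add_eq_0 add.commute)
  have "(\<Sum>i\<in>I. v i * real_of_rat (pivot M j0 k j i)) = 0" if "j \<in> J" for j
  proof -
    have "(\<Sum>i\<in>I. v i * real_of_rat (pivot M j0 k j i)) =
      (\<Sum>i\<in>I. v i * of_rat (M j i)) - of_rat (M j k) / of_rat (M j0 k) * (\<Sum>i\<in>I. v i * of_rat (M j0 i))"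
      by (simp add: pivot_def of_rat_diff of_rat_mult of_rat_divide sum_subtractf sum_distrib_left
          algebra_simps)
    also have "\<dots> = 0"
      using eq[OF that] eq[OF j0(1)] j0(2) by simp
    finally show ?thesis .
  qed
  then have vI: "v i = 0" if "i \<in> I" for i
    using insert.IH[OF trivial_kernel_pivot[OF insert(4,1,2) j0], of i] that by simp
  then have "v k = 0" using eq[OF j0(1)] j0(2) by simp
  then show ?case using vI insert.prems by auto
qed

text \<open>Linear substitution, proved by elimination; \<open>C\<close> is the inverse absolute
  determinant, and only its positivity matters. The translation \<open>s\<close> is needed for the
  induction: once the value of the pivot row is fixed, the other rows become affine.
  \<open>C\<close> must depend on neither \<open>s\<close> nor \<open>F\<close>.\<close>

lemma nn_integral_PiM_affine:
  fixes M :: "'j \<Rightarrow> 'i \<Rightarrow> rat"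
  assumes "finite I" "finite J" "card I = card J" "trivial_kernel M I J"
  shows "\<exists>C>0. \<forall>s. \<forall>F\<in>borel_measurable (lborelP J).
    (\<integral>\<^sup>+z. F (\<lambda>j\<in>J. (\<Sum>i\<in>I. z i * of_rat (M j i)) + s j) \<partial>lborelP I)
      = ennreal C * (\<integral>\<^sup>+w. F w \<partial>lborelP J)"
  using assms
proof (induction I arbitrary: J M)
  case empty
  then have "J = {}" by simp
  then show ?case
    by (intro exI[of _ 1]) (simp add: lborelP.nn_integral_empty restrict_def del: nn_integral_const)
next
  case (insert k I)
  obtain j0 where j0: "j0 \<in> J" "M j0 k \<noteq> 0"
    using trivial_kernel_pivot_exists[OF insert(6,1,2)] by blast
  define J' where "J' = J - {j0}"
  have J': "J = insert j0 J'" "j0 \<notin> J'" "finite J'"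
    using j0 insert by (auto simp: J'_def)
  define M' where "M' = pivot M j0 k"
  have "card I = card J'" using insert J' by simp
  moreover have "trivial_kernel M' I J'"
    unfolding M'_def J'_def by (rule trivial_kernel_pivot[OF insert(6,1,2) j0])
  ultimately obtain C where C: "C > 0" and IH: "\<And>s F. F\<in>borel_measurable (lborelP J') \<Longrightarrow>
    (\<integral>\<^sup>+z. F (\<lambda>j\<in>J'. (\<Sum>i\<in>I. z i * of_rat (M' j i)) + s j) \<partial>lborelP I)
      = ennreal C * (\<integral>\<^sup>+w. F w \<partial>lborelP J')"
    using insert.IH[OF J'(3), of M'] by blast
  define m where "m j = real_of_rat (M j k)" for j
  have m0: "m j0 \<noteq> 0" using j0 by (simp add: m_def)
  have M': "real_of_rat (M' j i) = of_rat (M j i) - m j / m j0 * of_rat (M j0 i)" for j i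
    by (simp add: M'_def pivot_def m_def of_rat_diff of_rat_mult of_rat_divide)
  have main: "(\<integral>\<^sup>+z. F (\<lambda>j\<in>J. (\<Sum>i\<in>insert k I. z i * of_rat (M j i)) + s j) \<partial>lborelP (insert k I))
      = ennreal (C / \<bar>m j0\<bar>) * (\<integral>\<^sup>+w. F w \<partial>lborelP J)"
    if F [measurable]: "F \<in> borel_measurable (lborelP J)" for F s
  proof -
    \<comment> \<open>Translation of row \<open>j\<close> after the variable \<open>k\<close> has
      been replaced by the value \<open>t\<close> of the pivot row.\<close>
    define s' where "s' t j = s j + m j / m j0 * (t - s j0)" for t j
    define K where "K z t = F ((\<lambda>j\<in>J'. (\<Sum>i\<in>I. z i * of_rat (M' j i)) + s' t j)(j0 := t))" for z t
    have K: "K z t = F (\<lambda>j\<in>J. if j = j0 then t else (\<Sum>i\<in>I. z i * of_rat (M' j i)) + s' t j)" for z t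
      unfolding K_def by (rule arg_cong[where f = F]) (auto simp: J' restrict_def fun_eq_iff)
    have [measurable]: "(\<lambda>p. K (fst p) (snd p)) \<in> borel_measurable (lborelP I \<Otimes>\<^sub>M lborel)"
      unfolding K s'_def by measurable
    have Kt: "(\<lambda>t. K z t) \<in> borel_measurable borel" if "z \<in> space (lborelP I)" for z
      using measurable_compose[OF measurable_Pair1'[OF that] 
          \<open>(\<lambda>p. K (fst p) (snd p)) \<in> borel_measurable (lborelP I \<Otimes>\<^sub>M lborel)\<close>] by simp
    have inner: "(\<integral>\<^sup>+x. F (\<lambda>j\<in>J. (\<Sum>i\<in>insert k I. (z(k := x)) i * of_rat (M j i)) + s j) \<partial>lborel)
      = ennreal (1 / \<bar>m j0\<bar>) * (\<integral>\<^sup>+t. K z t \<partial>lborel)" if z: "z \<in> space (lborelP I)" for z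
    proof -
      define T where "T = (\<Sum>i\<in>I. z i * real_of_rat (M j0 i)) + s j0"
      have "(\<lambda>x. F (\<lambda>j\<in>J. (\<Sum>i\<in>insert k I. (z(k := x)) i * of_rat (M j i)) + s j))
        = (\<lambda>x. K z (T + m j0 * x))"
      proof
        fix x
        have "(\<Sum>i\<in>insert k I. (z(k := x)) i * of_rat (M j i)) + s j =
          (if j = j0 then T + m j0 * x
           else (\<Sum>i\<in>I. z i * of_rat (M' j i)) + s' (T + m j0 * x) j)" for j
        proof -
          have "(\<Sum>i\<in>insert k I. (z(k := x)) i * of_rat (M j i)) =
             x * m j + (\<Sum>i\<in>I. z i * of_rat (M j i))"
            using insert.hyps by (simp add: m_def) (intro sum.cong, auto)
          moreover have "(\<Sum>i\<in>I. z i * of_rat (M' j i)) =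
            (\<Sum>i\<in>I. z i * of_rat (M j i)) - m j / m j0 * (T - s j0)"
            by (simp add: M' T_def sum_subtractf sum_distrib_left algebra_simps)
          ultimately show ?thesis
            using m0 by (simp add: s'_def T_def field_simps)
        qed
        then show "F (\<lambda>j\<in>J. (\<Sum>i\<in>insert k I. (z(k := x)) i * of_rat (M j i)) + s j)
          = K z (T + m j0 * x)" by (simp add: K)
      qed
      moreover have "(\<integral>\<^sup>+t. K z t \<partial>lborel) = ennreal \<bar>m j0\<bar> * (\<integral>\<^sup>+x. K z (T + m j0 * x) \<partial>lborel)"
        using Kt[OF z] m0 by (rule nn_integral_real_affine)
      ultimately show ?thesis
        using m0 by (simp add: mult.assoc[symmetric] ennreal_mult[symmetric])
    qed
    have "(\<lambda>z. F (\<lambda>j\<in>J. (\<Sum>i\<in>insert k I. z i * of_rat (M j i)) + s j))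
      \<in> borel_measurable (lborelP (insert k I))"
      by measurable
    then have "(\<integral>\<^sup>+z. F (\<lambda>j\<in>J. (\<Sum>i\<in>insert k I. z i * of_rat (M j i)) + s j) \<partial>lborelP (insert k I))
      = (\<integral>\<^sup>+z. (\<integral>\<^sup>+x. F (\<lambda>j\<in>J. (\<Sum>i\<in>insert k I. (z(k := x)) i * of_rat (M j i)) + s j) \<partial>lborel)
          \<partial>lborelP I)"
      using insert.hyps by (rule lborelP.product_nn_integral_insert[rotated 2])
    also have "\<dots> = (\<integral>\<^sup>+z. ennreal (1 / \<bar>m j0\<bar>) * (\<integral>\<^sup>+t. K z t \<partial>lborel) \<partial>lborelP I)"
      by (intro nn_integral_cong inner)
    also have "\<dots> = ennreal (1 / \<bar>m j0\<bar>) * (\<integral>\<^sup>+z. (\<integral>\<^sup>+t. K z t \<partial>lborel) \<partial>lborelP I)"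
      by (intro nn_integral_cmult) measurable
    \<comment> \<open>The order is exchanged so that the induction hypothesis applies for each fixed
      value \<open>t\<close> of the pivot row.\<close>
    also have "(\<integral>\<^sup>+z. (\<integral>\<^sup>+t. K z t \<partial>lborel) \<partial>lborelP I) = (\<integral>\<^sup>+t. (\<integral>\<^sup>+z. K z t \<partial>lborelP I) \<partial>lborel)"
    proof -
      interpret I: finite_product_sigma_finite "\<lambda>_. lborel :: real measure" I
        by standard (rule insert.hyps)
      interpret pair_sigma_finite "lborelP I" "lborel :: real measure" ..
      show ?thesis by (rule Fubini'[symmetric]) (simp add: case_prod_beta')
    qed
    also have "\<dots> = (\<integral>\<^sup>+t. ennreal C * (\<integral>\<^sup>+w. F (w(j0 := t)) \<partial>lborelP J') \<partial>lborel)"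
    proof (intro nn_integral_cong)
      fix t :: real
      have "(\<lambda>w. w(j0 := t)) \<in> measurable (lborelP J') (lborelP J)"
        by (rule measurable_fun_upd) (auto simp: J')
      then have "(\<lambda>w. F (w(j0 := t))) \<in> borel_measurable (lborelP J')" by measurable
      from IH[OF this, of "s' t"] show "(\<integral>\<^sup>+z. K z t \<partial>lborelP I) = ennreal C * (\<integral>\<^sup>+w. F (w(j0 := t)) \<partial>lborelP J')"
        by (simp add: K_def)
    qed
    also have "\<dots> = ennreal C * (\<integral>\<^sup>+t. (\<integral>\<^sup>+w. F (w(j0 := t)) \<partial>lborelP J') \<partial>lborel)"
    proof (rule nn_integral_cmult)
      have "(\<lambda>p. (snd p)(j0 := fst p)) \<in> measurable (lborel \<Otimes>\<^sub>M lborelP J') (lborelP J)"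
        by (rule measurable_fun_upd) (auto simp: J')
      then have [measurable]: "(\<lambda>p. F ((snd p)(j0 := fst p))) \<in> borel_measurable (lborel \<Otimes>\<^sub>M lborelP J')"
        by measurable
      interpret I: finite_product_sigma_finite "\<lambda>_. lborel :: real measure" J'
        by standard (rule J')
      show "(\<lambda>t. \<integral>\<^sup>+w. F (w(j0 := t)) \<partial>lborelP J') \<in> borel_measurable lborel"
        by (rule I.borel_measurable_nn_integral) (simp add: case_prod_beta')
    qed
    also have "(\<integral>\<^sup>+t. (\<integral>\<^sup>+w. F (w(j0 := t)) \<partial>lborelP J') \<partial>lborel) = (\<integral>\<^sup>+w. F w \<partial>lborelP J)"
      using F lborelP.product_nn_integral_insert_rev[OF J'(3,2), of F] by (simp add: J'(1))
    finally show ?thesis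
      using C
      by (simp add: mult.assoc[symmetric] ennreal_mult[symmetric] del: restrict_apply)
  qed
  have "0 < C / \<bar>m j0\<bar>" using C m0 by simp
  then show ?case
    by (intro exI[of _ "C / \<bar>m j0\<bar>"] conjI allI ballI main)
qed

section \<open>Integration along rays through an affine chart\<close>

lemma nn_integral_PiM_scale:
  assumes "finite I" "F \<in> borel_measurable (lborelP I)" "t \<noteq> 0"
  shows "(\<integral>\<^sup>+z. F z \<partial>lborelP I) = ennreal (\<bar>t\<bar> ^ card I) * (\<integral>\<^sup>+z. F (\<lambda>i\<in>I. t * z i) \<partial>lborelP I)"
  using assms(1,2)
proof (induction I arbitrary: F)
  case empty
  then show ?case by (simp add: lborelP.nn_integral_empty restrict_def del: nn_integral_const)
next
  case (insert k I)
  note [measurable] = insert.prems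
  have upd: "(\<lambda>p. (fst p)(k := snd p)) \<in> measurable (lborelP I \<Otimes>\<^sub>M lborel) (lborelP (insert k I))"
    by (rule measurable_fun_upd) auto
  then have [measurable]: "(\<lambda>p. F ((fst p)(k := snd p))) \<in> borel_measurable (lborelP I \<Otimes>\<^sub>M lborel)"
    by measurable
  have upd1: "(\<lambda>x. F (z(k := x))) \<in> borel_measurable borel" if "z \<in> space (lborelP I)" for z
    using measurable_compose[OF measurable_Pair1'[OF that]
        \<open>(\<lambda>p. F ((fst p)(k := snd p))) \<in> borel_measurable (lborelP I \<Otimes>\<^sub>M lborel)\<close>] by simp
  have "(\<integral>\<^sup>+z. F z \<partial>lborelP (insert k I)) = (\<integral>\<^sup>+z. (\<integral>\<^sup>+x. F (z(k := x)) \<partial>lborel) \<partial>lborelP I)"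
    using insert by (intro lborelP.product_nn_integral_insert)
  also have "\<dots> = (\<integral>\<^sup>+z. ennreal \<bar>t\<bar> * (\<integral>\<^sup>+x. F (z(k := t * x)) \<partial>lborel) \<partial>lborelP I)"
    using nn_integral_real_affine[OF upd1 assms(3), where t = 0] by (intro nn_integral_cong) simp
  also have "\<dots> = ennreal (\<bar>t\<bar> ^ card I) *
      (\<integral>\<^sup>+z. ennreal \<bar>t\<bar> * (\<integral>\<^sup>+x. F ((\<lambda>i\<in>I. t * z i)(k := t * x)) \<partial>lborel) \<partial>lborelP I)"
  proof (rule insert.IH)
    have "(\<lambda>p. (fst p)(k := t * snd p)) \<in> measurable (lborelP I \<Otimes>\<^sub>M lborel) (lborelP (insert k I))"
      by (rule measurable_fun_upd) auto
    then have [measurable]: "(\<lambda>p. F ((fst p)(k := t * snd p))) \<in> borel_measurable (lborelP I \<Otimes>\<^sub>M lborel)"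
      by measurable
    have "(\<lambda>z. \<integral>\<^sup>+x. F (z(k := t * x)) \<partial>lborel) \<in> borel_measurable (lborelP I)"
      by (rule lborel.borel_measurable_nn_integral) (simp add: case_prod_beta')
    then show "(\<lambda>z. ennreal \<bar>t\<bar> * (\<integral>\<^sup>+x. F (z(k := t * x)) \<partial>lborel)) \<in> borel_measurable (lborelP I)"
      by measurable
  qed
  also have "\<dots> = ennreal (\<bar>t\<bar> ^ card I) *
      (\<integral>\<^sup>+z. ennreal \<bar>t\<bar> * (\<integral>\<^sup>+x. F (\<lambda>i\<in>insert k I. t * (z(k := x)) i) \<partial>lborel) \<partial>lborelP I)"
  proof -
    have "(\<lambda>i\<in>I. t * z i)(k := t * x) = (\<lambda>i\<in>insert k I. t * (z(k := x)) i)" for z x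
      using insert.hyps by (auto simp: restrict_def fun_eq_iff)
    then show ?thesis by simp
  qed
  also have "\<dots> = ennreal (\<bar>t\<bar> ^ card I) * (ennreal \<bar>t\<bar> *
      (\<integral>\<^sup>+z. (\<integral>\<^sup>+x. F (\<lambda>i\<in>insert k I. t * (z(k := x)) i) \<partial>lborel) \<partial>lborelP I))"
  proof (subst nn_integral_cmult)
    have "(\<lambda>p. F (\<lambda>i\<in>insert k I. t * ((fst p)(k := snd p)) i)) \<in> borel_measurable (lborelP I \<Otimes>\<^sub>M lborel)"
      by measurable
    then show "(\<lambda>z. \<integral>\<^sup>+x. F (\<lambda>i\<in>insert k I. t * (z(k := x)) i) \<partial>lborel) \<in> borel_measurable (lborelP I)"
      by (intro lborel.borel_measurable_nn_integral) (simp add: case_prod_beta')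
  qed simp
  also have "(\<integral>\<^sup>+z. (\<integral>\<^sup>+x. F (\<lambda>i\<in>insert k I. t * (z(k := x)) i) \<partial>lborel) \<partial>lborelP I)
      = (\<integral>\<^sup>+z. F (\<lambda>i\<in>insert k I. t * z i) \<partial>lborelP (insert k I))"
    using insert.hyps by (intro lborelP.product_nn_integral_insert[symmetric]) measurable
  finally show ?case
    using insert.hyps
    by (simp add: mult.assoc[symmetric] ennreal_mult[symmetric] mult.commute del: restrict_apply)
qed

text \<open>Substitution \<open>z = t * (x(k := 1))\<close>: for fixed last coordinate
  \<open>t\<close>, the others are rescaled by \<open>t\<close>, with Jacobian the power
  \<open>card I\<close> of \<open>\<bar>t\<bar>\<close>.\<close>

lemma nn_integral_cone:
  assumes "finite I" "k \<notin> I" and F [measurable]: "F \<in> borel_measurable (lborelP (insert k I))"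
  shows "(\<integral>\<^sup>+z. F z \<partial>lborelP (insert k I)) =
    (\<integral>\<^sup>+x. (\<integral>\<^sup>+t. ennreal (\<bar>t\<bar> ^ card I) * F (\<lambda>i\<in>insert k I. t * (x(k := 1)) i) \<partial>lborel) \<partial>lborelP I)"
proof -
  interpret I: finite_product_sigma_finite "\<lambda>_. lborel :: real measure" I
    by standard (rule assms)
  interpret pair_sigma_finite "lborelP I" "lborel :: real measure" ..
  have upd1: "(\<lambda>x. x(k := t)) \<in> measurable (lborelP I) (lborelP (insert k I))" for t :: real
    by (rule measurable_fun_upd) auto
  have upd: "(\<lambda>x. F (x(k := t))) \<in> borel_measurable (lborelP I)" for t
    by (rule measurable_compose[OF upd1 F])
  have scaled: "(\<lambda>x. F (\<lambda>i\<in>insert k I. t * (x(k := 1)) i)) \<in> borel_measurable (lborelP I)" for t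
  proof -
    have "(\<lambda>z. F (\<lambda>i\<in>insert k I. t * z i)) \<in> borel_measurable (lborelP (insert k I))"
      by measurable
    from measurable_compose[OF upd1[of 1] this] show ?thesis .
  qed
  have "(\<integral>\<^sup>+z. F z \<partial>lborelP (insert k I)) = (\<integral>\<^sup>+t. (\<integral>\<^sup>+x. F (x(k := t)) \<partial>lborelP I) \<partial>lborel)"
    using assms by (intro lborelP.product_nn_integral_insert_rev)
  also have "\<dots> = (\<integral>\<^sup>+t. (\<integral>\<^sup>+x. ennreal (\<bar>t\<bar> ^ card I) * F (\<lambda>i\<in>insert k I. t * (x(k := 1)) i) \<partial>lborelP I) \<partial>lborel)"
  \<comment> \<open>Rescaling is impossible at \<open>t = 0\<close>, which is a null set.\<close>
  proof (rule nn_integral_cong_AE, rule AE_mp[OF AE_lborel_singleton[of "0 :: real"] AE_I2], rule impI)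
    fix t :: real
    assume t: "t \<noteq> 0"
    have "(\<lambda>i\<in>I. t * x i)(k := t) = (\<lambda>i\<in>insert k I. t * (x(k := 1)) i)" for x
      using assms by (auto simp: restrict_def fun_eq_iff)
    then have "(\<integral>\<^sup>+x. F (x(k := t)) \<partial>lborelP I) =
      ennreal (\<bar>t\<bar> ^ card I) * (\<integral>\<^sup>+x. F (\<lambda>i\<in>insert k I. t * (x(k := 1)) i) \<partial>lborelP I)"
      by (subst nn_integral_PiM_scale[OF assms(1) upd t]) simp
    also have "\<dots> = (\<integral>\<^sup>+x. ennreal (\<bar>t\<bar> ^ card I) * F (\<lambda>i\<in>insert k I. t * (x(k := 1)) i) \<partial>lborelP I)"
      by (intro nn_integral_cmult[symmetric] scaled)
    finally show "(\<integral>\<^sup>+x. F (x(k := t)) \<partial>lborelP I) = \<dots>" .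
  qed
  also have "\<dots> = (\<integral>\<^sup>+x. (\<integral>\<^sup>+t. ennreal (\<bar>t\<bar> ^ card I) * F (\<lambda>i\<in>insert k I. t * (x(k := 1)) i) \<partial>lborel) \<partial>lborelP I)"
    by (rule Fubini') measurable
  finally show ?thesis .
qed

text \<open>The integral over the slab \<open>1/2 \<le> g \<le> 1\<close> is the integral over the chart \<^prop>\<open>z k = 1\<close>,
  weighted by the logarithmic length of the part of each ray that lies in the slab.\<close>

definition slab :: "('a \<Rightarrow> real) \<Rightarrow> 'a \<Rightarrow> ennreal" where
  "slab g z = indicator {1/2..1} (g z)"

text \<open>Homogeneity of degree minus the dimension of the space combines with the Jacobian to the
  scale-invariant density \<open>1 / \<bar>t\<bar>\<close> on each ray, so \<open>f\<close> leaves
  the inner integral.\<close>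

lemma nn_integral_slab:
  fixes f :: "('i \<Rightarrow> real) \<Rightarrow> ennreal"
  assumes I: "finite I" "k \<notin> I"
    and f [measurable]: "f \<in> borel_measurable (lborelP (insert k I))"
    and g [measurable]: "g \<in> borel_measurable (lborelP (insert k I))"
    and hom: "\<And>t z. t \<noteq> 0 \<Longrightarrow>
      f (\<lambda>i\<in>insert k I. t * z i) = ennreal (inverse (\<bar>t\<bar> ^ Suc (card I))) * f z"
    and g0: "\<And>z. g (\<lambda>i\<in>insert k I. 0 * z i) = 0"
  shows "(\<integral>\<^sup>+z. f z * slab g z \<partial>lborelP (insert k I)) =
    (\<integral>\<^sup>+x. f (x(k := 1)) *
      (\<integral>\<^sup>+t. ennreal (inverse \<bar>t\<bar>) * slab g (\<lambda>i\<in>insert k I. t * (x(k := 1)) i) \<partial>lborel) \<partial>lborelP I)"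
proof -
  have [measurable]: "slab g \<in> borel_measurable (lborelP (insert k I))"
    unfolding slab_def[abs_def] by measurable
  have "(\<integral>\<^sup>+z. f z * slab g z \<partial>lborelP (insert k I)) =
    (\<integral>\<^sup>+x. (\<integral>\<^sup>+t. ennreal (\<bar>t\<bar> ^ card I) * (f (\<lambda>i\<in>insert k I. t * (x(k := 1)) i)
      * slab g (\<lambda>i\<in>insert k I. t * (x(k := 1)) i)) \<partial>lborel) \<partial>lborelP I)"
    using I by (intro nn_integral_cone) measurable
  also have "\<dots> = (\<integral>\<^sup>+x. (\<integral>\<^sup>+t. f (x(k := 1)) * (ennreal (inverse \<bar>t\<bar>) *
      slab g (\<lambda>i\<in>insert k I. t * (x(k := 1)) i)) \<partial>lborel) \<partial>lborelP I)"
  proof (intro nn_integral_cong)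
    fix x and t :: real
    show "ennreal (\<bar>t\<bar> ^ card I) * (f (\<lambda>i\<in>insert k I. t * (x(k := 1)) i)
      * slab g (\<lambda>i\<in>insert k I. t * (x(k := 1)) i)) =
      f (x(k := 1)) * (ennreal (inverse \<bar>t\<bar>) * slab g (\<lambda>i\<in>insert k I. t * (x(k := 1)) i))"
    proof (cases "t = 0")
      case True
      then have "slab g (\<lambda>i\<in>insert k I. t * (x(k := 1)) i) = 0"
        using g0 by (simp add: slab_def del: restrict_apply mult_zero_left)
      then show ?thesis by simp
    next
      case False
      then have "ennreal (\<bar>t\<bar> ^ card I) * ennreal (inverse (\<bar>t\<bar> ^ Suc (card I))) = ennreal (inverse \<bar>t\<bar>)"
        by (simp add: ennreal_mult[symmetric] field_simps)
      moreover have "u * (v * w * r) = w * ((u * v) * r)" for u v w r :: ennreal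
        by (simp add: mult_ac)
      ultimately show ?thesis unfolding hom[OF False] by (metis (no_types))
    qed
  qed
  also have "\<dots> = (\<integral>\<^sup>+x. f (x(k := 1)) * (\<integral>\<^sup>+t. ennreal (inverse \<bar>t\<bar>) *
      slab g (\<lambda>i\<in>insert k I. t * (x(k := 1)) i) \<partial>lborel) \<partial>lborelP I)"
  proof (intro nn_integral_cong nn_integral_cmult)
    fix x assume "x \<in> space (lborelP I)"
    then have "(\<lambda>t. \<lambda>i\<in>insert k I. t * (x(k := 1)) i) \<in> measurable lborel (lborelP (insert k I))"
      by measurable
    then show "(\<lambda>t. ennreal (inverse \<bar>t\<bar>) * slab g (\<lambda>i\<in>insert k I. t * (x(k := 1)) i)) \<in> borel_measurable lborel"
      by measurable
  qed
  finally show ?thesis .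
qed

text \<open>Version for a positive gauge \<open>g\<close>, such as a maximum norm: every ray has
  logarithmic length at least 1/2 in the slab. The positive half of the ray suffices.\<close>

lemma nn_integral_chart_le_slab:
  fixes f :: "('i \<Rightarrow> real) \<Rightarrow> ennreal"
  assumes I: "finite I" "k \<notin> I"
    and f [measurable]: "f \<in> borel_measurable (lborelP (insert k I))"
    and g [measurable]: "g \<in> borel_measurable (lborelP (insert k I))"
    and hom: "\<And>t z. t \<noteq> 0 \<Longrightarrow>
      f (\<lambda>i\<in>insert k I. t * z i) = ennreal (inverse (\<bar>t\<bar> ^ Suc (card I))) * f z"
    and ghom: "\<And>t z. t \<ge> 0 \<Longrightarrow> g (\<lambda>i\<in>insert k I. t * z i) = t * g z"
    and pos: "\<And>x. g (x(k := 1)) > 0"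
  shows "(\<integral>\<^sup>+x. f (x(k := 1)) \<partial>lborelP I) \<le> 2 * (\<integral>\<^sup>+z. f z * slab g z \<partial>lborelP (insert k I))"
proof -
  have upd [measurable]: "(\<lambda>x. x(k := 1)) \<in> measurable (lborelP I) (lborelP (insert k I))"
    by (rule measurable_fun_upd) auto
  have g0: "g (\<lambda>i\<in>insert k I. 0 * z i) = 0" for z
    using ghom[of 0 z] by (simp del: restrict_apply)
  have slab_eq: "(\<integral>\<^sup>+z. f z * slab g z \<partial>lborelP (insert k I)) =
    (\<integral>\<^sup>+x. f (x(k := 1)) *
      (\<integral>\<^sup>+t. ennreal (inverse \<bar>t\<bar>) * slab g (\<lambda>i\<in>insert k I. t * (x(k := 1)) i) \<partial>lborel) \<partial>lborelP I)"
    by (intro nn_integral_slab I f g hom g0)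
  have ray: "ennreal (1 / 2) \<le> (\<integral>\<^sup>+t. ennreal (inverse \<bar>t\<bar>) * slab g (\<lambda>i\<in>insert k I. t * (x(k := 1)) i) \<partial>lborel)" for x
  proof -
    define c where "c = g (x(k := 1))"
    have c: "c > 0" using pos by (simp add: c_def)
    \<comment> \<open>On the interval from \<open>1/(2*c)\<close> to \<open>1/c\<close> the ray is
      in the slab and the density is at least \<open>c\<close>.\<close>
    have "ennreal (1 / 2) = ennreal c * emeasure lborel {1/(2*c)..1/c}"
      using c by (simp add: ennreal_mult[symmetric] field_simps)
    also have "\<dots> = (\<integral>\<^sup>+t. ennreal c * indicator {1/(2*c)..1/c} t \<partial>lborel)"
      by (simp add: nn_integral_cmult_indicator)
    also have "\<dots> \<le> (\<integral>\<^sup>+t. ennreal (inverse \<bar>t\<bar>) * slab g (\<lambda>i\<in>insert k I. t * (x(k := 1)) i) \<partial>lborel)"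
    proof (intro nn_integral_mono)
      fix t :: real
      show "ennreal c * indicator {1/(2*c)..1/c} t \<le>
        ennreal (inverse \<bar>t\<bar>) * slab g (\<lambda>i\<in>insert k I. t * (x(k := 1)) i)"
      proof (cases "t \<in> {1/(2*c)..1/c}")
        case True
        have "0 < 1 / (2 * c)" using c by simp
        then have t: "t > 0" using True by (meson atLeastAtMost_iff less_le_trans)
        have "1 / 2 \<le> t * c" "t * c \<le> 1" using True c by (auto simp: field_simps)
        then have "slab g (\<lambda>i\<in>insert k I. t * (x(k := 1)) i) = 1"
          using ghom[of t "x(k := 1)"] t by (simp add: slab_def c_def del: restrict_apply)
        moreover have "c \<le> inverse \<bar>t\<bar>" using \<open>t * c \<le> 1\<close> t by (simp add: field_simps)
        ultimately show ?thesis using True by (simp add: ennreal_leI)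
      qed simp
    qed
    finally show ?thesis .
  qed
  have "(\<integral>\<^sup>+x. f (x(k := 1)) \<partial>lborelP I) = 2 * (\<integral>\<^sup>+x. f (x(k := 1)) * ennreal (1 / 2) \<partial>lborelP I)"
  proof (subst nn_integral_multc)
    show "(\<lambda>x. f (x(k := 1))) \<in> borel_measurable (lborelP I)"
      by (rule measurable_compose[OF upd f])
    have *: "2 * ennreal (1 / 2) = 1"
      using ennreal_mult[of 2 "1/2"] by simp
    show "(\<integral>\<^sup>+x. f (x(k := 1)) \<partial>lborelP I) = 2 * ((\<integral>\<^sup>+x. f (x(k := 1)) \<partial>lborelP I) * ennreal (1 / 2))"
      by (simp only: mult.left_commute[of 2] * mult_1_right)
  qed
  also have "\<dots> \<le> 2 * (\<integral>\<^sup>+z. f z * slab g z \<partial>lborelP (insert k I))"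
    unfolding slab_eq by (intro mult_left_mono nn_integral_mono ray zero_le)
  finally show ?thesis .
qed

text \<open>Version for a signed linear \<open>g\<close>, which may vanish on some rays: the part of
  a ray in the slab has length at most \<open>1 / (2 * \<bar>c\<bar>)\<close>, with density at most
  \<open>2 * \<bar>c\<bar>\<close>.\<close>

lemma nn_integral_slab_le_chart:
  fixes f :: "('i \<Rightarrow> real) \<Rightarrow> ennreal"
  assumes I: "finite I" "k \<notin> I"
    and f [measurable]: "f \<in> borel_measurable (lborelP (insert k I))"
    and g [measurable]: "g \<in> borel_measurable (lborelP (insert k I))"
    and hom: "\<And>t z. t \<noteq> 0 \<Longrightarrow>
      f (\<lambda>i\<in>insert k I. t * z i) = ennreal (inverse (\<bar>t\<bar> ^ Suc (card I))) * f z"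
    and ghom: "\<And>t z. g (\<lambda>i\<in>insert k I. t * z i) = t * g z"
  shows "(\<integral>\<^sup>+z. f z * slab g z \<partial>lborelP (insert k I)) \<le> (\<integral>\<^sup>+x. f (x(k := 1)) \<partial>lborelP I)"
proof -
  have g0: "g (\<lambda>i\<in>insert k I. 0 * z i) = 0" for z
    using ghom[of 0 z] by (simp del: restrict_apply)
  have slab_eq: "(\<integral>\<^sup>+z. f z * slab g z \<partial>lborelP (insert k I)) =
    (\<integral>\<^sup>+x. f (x(k := 1)) *
      (\<integral>\<^sup>+t. ennreal (inverse \<bar>t\<bar>) * slab g (\<lambda>i\<in>insert k I. t * (x(k := 1)) i) \<partial>lborel) \<partial>lborelP I)"
    by (intro nn_integral_slab I f g hom g0)
  have ray: "(\<integral>\<^sup>+t. ennreal (inverse \<bar>t\<bar>) * slab g (\<lambda>i\<in>insert k I. t * (x(k := 1)) i) \<partial>lborel) \<le> 1" for x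
  proof -
    define c where "c = g (x(k := 1))"
    define l where "l = min (1/(2*c)) (1/c)"
    define u where "u = max (1/(2*c)) (1/c)"
    \<comment> \<open>The minimum and maximum cover both signs of \<open>c\<close>. For
      \<open>c = 0\<close> the convention \<open>1 / 0 = 0\<close> makes both sides 0, and the ray
      misses the slab.\<close>
    have lu: "u - l = 1 / (2 * \<bar>c\<bar>)"
    proof (cases c "0 :: real" rule: linorder_cases)
      case less
      then have "1 / c \<le> 1 / (2 * c)" by (simp add: field_simps)
      then show ?thesis using less by (simp add: l_def u_def field_simps)
    next
      case greater
      then have "1 / (2 * c) \<le> 1 / c" by (simp add: field_simps)
      then show ?thesis using greater by (simp add: l_def u_def field_simps)
    qed (simp add: l_def u_def)
    have "(\<integral>\<^sup>+t. ennreal (inverse \<bar>t\<bar>) * slab g (\<lambda>i\<in>insert k I. t * (x(k := 1)) i) \<partial>lborel)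
      \<le> (\<integral>\<^sup>+t. ennreal (2 * \<bar>c\<bar>) * indicator {l..u} t \<partial>lborel)"
    proof (intro nn_integral_mono)
      fix t :: real
      show "ennreal (inverse \<bar>t\<bar>) * slab g (\<lambda>i\<in>insert k I. t * (x(k := 1)) i)
        \<le> ennreal (2 * \<bar>c\<bar>) * indicator {l..u} t"
      proof (cases "1 / 2 \<le> t * c \<and> t * c \<le> 1")
        case True
        then have nz: "t \<noteq> 0" "c \<noteq> 0" by auto
        have "t \<in> {l..u}"
          using True nz by (cases "c > 0") (auto simp: l_def u_def min_def max_def field_simps)
        moreover have "1 / 2 \<le> \<bar>t * c\<bar>" using True by linarith
        then have "inverse \<bar>t\<bar> \<le> 2 * \<bar>c\<bar>"
          using nz by (simp add: abs_mult field_simps)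
        ultimately show ?thesis by (simp add: slab_def indicator_def ennreal_leI)
      next
        case False
        then show ?thesis using ghom[of t "x(k := 1)"]
          by (simp add: slab_def c_def del: restrict_apply)
      qed
    qed
    also have "\<dots> = ennreal (2 * \<bar>c\<bar>) * ennreal (u - l)"
      by (simp add: nn_integral_cmult_indicator l_def u_def)
    also have "\<dots> \<le> 1"
      by (simp add: lu ennreal_mult[symmetric] ennreal_le_1)
    finally show ?thesis .
  qed
  have "(\<integral>\<^sup>+z. f z * slab g z \<partial>lborelP (insert k I)) \<le> (\<integral>\<^sup>+x. f (x(k := 1)) * 1 \<partial>lborelP I)"
    unfolding slab_eq by (intro mult_left_mono nn_integral_mono ray zero_le)
  then show ?thesis by simp
qed

text \<open>The value at \<open>0\<close> is \<open>\<infinity>\<close>, in contrast to \<^term>\<open>0 powr (- s) = 0\<close>.\<close>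

definition cut_powr :: "real \<Rightarrow> real \<Rightarrow> ennreal" where
  "cut_powr s t = (if t = 0 then \<infinity> else if \<bar>t\<bar> \<le> 1 then ennreal (\<bar>t\<bar> powr (- s)) else 0)"

lemma measurable_cut_powr [measurable]: "cut_powr s \<in> borel_measurable borel"
  unfolding cut_powr_def[abs_def] by measurable

lemma nn_integral_cut_powr_finite:
  assumes "s < 1"
  shows "(\<integral>\<^sup>+t. cut_powr s t \<partial>lborel) < \<infinity>"
proof -
  define h where "h t = ennreal (t powr (- s)) * indicator {0..1} t" for t :: real
  have [measurable]: "h \<in> borel_measurable borel" unfolding h_def[abs_def] by measurable
  have "((\<lambda>x. x powr (- s)) has_integral (1 powr (- s + 1) / (- s + 1))) {0..1}"
    using assms by (intro has_integral_powr_from_0) auto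
  then have "(\<integral>\<^sup>+t. h t \<partial>lborel) = ennreal (1 powr (- s + 1) / (- s + 1))"
    unfolding h_def by (intro nn_integral_has_integral_lebesgue') auto
  then have fin: "(\<integral>\<^sup>+t. h t \<partial>lborel) < \<infinity>" by simp
  \<comment> \<open>Away from the null set \<open>t = 0\<close>, where \<open>cut_powr\<close> is
    infinite, the function is bounded by two mirror images of the power function on the unit
    interval.\<close>
  have "(\<integral>\<^sup>+t. cut_powr s t \<partial>lborel) \<le> (\<integral>\<^sup>+t. h t + h (0 + (-1) * t) \<partial>lborel)"
  proof (intro nn_integral_mono_AE AE_mp[OF AE_lborel_singleton[of "0 :: real"] AE_I2] impI)
    fix t :: real assume "t \<noteq> 0"
    then show "cut_powr s t \<le> h t + h (0 + (-1) * t)"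
      by (auto simp: cut_powr_def h_def indicator_def abs_if)
  qed
  also have "\<dots> = (\<integral>\<^sup>+t. h t \<partial>lborel) + (\<integral>\<^sup>+t. h (0 + (-1) * t) \<partial>lborel)"
    by (intro nn_integral_add) auto
  also have "(\<integral>\<^sup>+t. h (0 + (-1) * t) \<partial>lborel) = (\<integral>\<^sup>+t. h t \<partial>lborel)"
    using nn_integral_real_affine[of h "-1" 0] by simp
  finally show ?thesis by (rule le_less_trans) (use fin in simp)
qed

section \<open>Edge functionals as coordinates\<close>

lemma sum_fun_apply: "(\<Sum>i\<in>A. f i) x = (\<Sum>i\<in>A. f i x)"
  by (induction A rule: infinite_finite_induct) auto

text \<open>The analysis sees the graph only through a space of dimension \<open>n\<close> on
  \<open>2 * n\<close> edges; incidence returns when cycle spaces of subgraphs are computed.\<close>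

locale cycle_coordinates =
  fixes E :: "'e set" and H :: "('e \<Rightarrow> rat) set" and n :: nat
    and B :: "nat \<Rightarrow> 4 \<Rightarrow> 'e \<Rightarrow> rat"
  assumes finite_E: "finite E" and card_E: "card E = 2 * n" and n: "n \<ge> 1"
    and H: "chain.subspace H" and dim_H: "chain.dim H = n"
    and support: "\<And>c e. c \<in> H \<Longrightarrow> e \<notin> E \<Longrightarrow> c e = 0"
    and inj_B: "inj_on B {1..4*n}" and indep_B: "tuple.independent (B ` {1..4*n})"
    and span_B: "tuple.span (B ` {1..4*n}) = {z. \<forall>a. z a \<in> H}"
begin

text \<open>An infinite basis would have \<open>card\<close> 0, contradicting
  \<open>n \<ge> 1\<close>.\<close>

lemma finite_dimensional: "\<exists>S. finite S \<and> H \<subseteq> chain.span S"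
proof -
  obtain S where "H \<subseteq> chain.span S" "card S = chain.dim H"
    using chain.basis_exists by blast
  then show ?thesis using dim_H n by (metis card.infinite not_one_le_zero)
qed

lemma vanishing_E: "vanishing H E = {0}"
  using support chain.subspace_0[OF H] by (fastforce simp: vanishing_def)

lemma edge_basis_E:
  assumes "edge_basis H b E"
  shows "b \<subseteq> E" "finite b" "card b = n" "vanishing H b = {0}"
proof -
  show "b \<subseteq> E" "vanishing H b = {0}"
    using assms vanishing_E by (auto simp: edge_basis_def)
  moreover have "chain.dim {0 :: 'e \<Rightarrow> rat} = 0"
    using chain.dim_span_eq_card_independent[OF chain.independent_empty] by simp
  ultimately show "card b = n"
    using assms dim_H by (simp add: edge_basis_def)
  show "finite b" using \<open>b \<subseteq> E\<close> finite_E by (rule finite_subset)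
qed

lemma extend_edge_basis:
  assumes "edge_basis H b F" "F \<subseteq> E"
  shows "\<exists>b'. b \<subseteq> b' \<and> edge_basis H b' E"
proof -
  obtain S where "finite S" "H \<subseteq> chain.span S" using finite_dimensional by blast
  from edge_basis_extend[OF H this assms(1), of E] show ?thesis
    using assms(2) finite_E finite_subset by (metis Un_absorb1)
qed

lemma edge_basis_exists:
  assumes "F \<subseteq> E"
  shows "\<exists>b. edge_basis H b F"
proof -
  obtain S where "finite S" "H \<subseteq> chain.span S" using finite_dimensional by blast
  from edge_basis_extend[OF H this edge_basis_empty, of F] show ?thesis
    using finite_subset[OF assms finite_E] by auto
qed

text \<open>\<open>coord (e, a) Z\<close> is \<open>\<ell>\<^sub>e(z\<^sub>a)\<close> for the point \<open>z\<close> with coordinates \<open>Z\<close>.\<close>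

definition coeff :: "'e \<times> 4 \<Rightarrow> nat \<Rightarrow> rat" where
  "coeff j k = B k (snd j) (fst j)"

definition coord :: "'e \<times> 4 \<Rightarrow> (nat \<Rightarrow> real) \<Rightarrow> real" where
  "coord j Z = (\<Sum>k\<in>{1..4*n}. Z k * of_rat (coeff j k))"

lemma coord_real_point: "real_point (4 * n) B Z a e = coord (e, a) Z"
  by (simp add: real_point_def coord_def coeff_def)

lemma measurable_coord [measurable]: "coord j \<in> borel_measurable (lborelP {1..4*n})"
  unfolding coord_def[abs_def] by measurable

lemma coord_scale: "coord j (\<lambda>i\<in>{1..4*n}. t * Z i) = t * coord j Z"
  by (simp add: coord_def sum_distrib_left mult.assoc)

lemma B_in_H: "k \<in> {1..4*n} \<Longrightarrow> B k a \<in> H"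
  using tuple.span_base[of "B k" "B ` {1..4*n}"] span_B by auto

lemma coord_combination:
  assumes "\<And>c. c \<in> H \<Longrightarrow> c e = (\<Sum>x\<in>b. \<gamma> x * c x)"
  shows "coord (e, a) Z = (\<Sum>x\<in>b. of_rat (\<gamma> x) * coord (x, a) Z)"
proof -
  have "coord (e, a) Z = (\<Sum>k\<in>{1..4*n}. \<Sum>x\<in>b. of_rat (\<gamma> x) * (Z k * of_rat (coeff (x, a) k)))"
    unfolding coord_def
    by (intro sum.cong refl)
      (simp add: coeff_def assms[OF B_in_H] of_rat_sum of_rat_mult sum_distrib_left mult_ac)
  also have "\<dots> = (\<Sum>x\<in>b. of_rat (\<gamma> x) * coord (x, a) Z)"
    by (subst sum.swap) (simp add: coord_def sum_distrib_left)
  finally show ?thesis .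
qed

text \<open>If all these coordinates of a rational point vanish, each of its four components lies in
  \<open>vanishing H b\<close>, so the point is 0 and independence of \<open>B\<close> gives zero
  coefficients.\<close>

lemma trivial_kernel_coeff:
  assumes "vanishing H b = {0}"
  shows "trivial_kernel coeff {1..4*n} (b \<times> UNIV)"
  unfolding trivial_kernel_def
proof (intro allI impI ballI)
  fix v :: "nat \<Rightarrow> rat" and i
  assume v: "\<forall>j\<in>b \<times> UNIV. (\<Sum>k\<in>{1..4*n}. v k * coeff j k) = 0" and i: "i \<in> {1..4*n}"
  define z where "z = (\<Sum>k\<in>{1..4*n}. tuple_scale (v k) (B k))"
  have z: "z a e = (\<Sum>k\<in>{1..4*n}. v k * coeff (e, a) k)" for a e
    by (simp add: z_def sum_fun_apply tuple_scale_def chain_scale_def coeff_def)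
  have "z \<in> tuple.span (B ` {1..4*n})"
    unfolding z_def by (intro tuple.span_sum tuple.span_scale tuple.span_base) auto
  then have "z a \<in> vanishing H b" for a
    using span_B v by (auto simp: vanishing_def z)
  then have "z a = 0" for a using assms by blast
  then have "z = 0" by (simp add: fun_eq_iff)
  \<comment> \<open>Coefficients are carried from the indices to the basis vectors, the form in
    which independence is stated.\<close>
  define u where "u x = v (the_inv_into {1..4*n} B x)" for x
  have u: "u (B k) = v k" if "k \<in> {1..4*n}" for k
    using the_inv_into_f_f[OF inj_B that] by (simp add: u_def)
  have "(\<Sum>x\<in>B ` {1..4*n}. tuple_scale (u x) x) = z"
    unfolding z_def by (subst sum.reindex[OF inj_B]) (simp add: u)
  with \<open>z = 0\<close> have "u (B i) = 0"
    using i by (intro tuple.independentD[OF indep_B, of "B ` {1..4*n}" u]) auto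
  then show "v i = 0" using u i by simp
qed

text \<open>A basis of \<open>n\<close> edges yields \<open>4 * n\<close> linear coordinates, and in
  these a product integrand separates into one-dimensional integrals.\<close>

lemma change_of_coords:
  assumes "edge_basis H b E"
  obtains C where "C > 0" "\<forall>F. (\<forall>j. F j \<in> borel_measurable borel) \<longrightarrow>
    (\<integral>\<^sup>+Z. (\<Prod>j\<in>b \<times> UNIV. F j (coord j Z)) \<partial>lborelP {1..4*n})
      = ennreal C * (\<Prod>j\<in>b \<times> UNIV. \<integral>\<^sup>+t. F j t \<partial>lborel)"
proof -
  note b = edge_basis_E[OF assms]
  have fin: "finite (b \<times> (UNIV :: 4 set))" using b by simp
  have "card {1..4*n} = card (b \<times> (UNIV :: 4 set))"
    using b by (simp add: card_cartesian_product)
  from nn_integral_PiM_affine[OF _ fin this trivial_kernel_coeff[OF b(4)]]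
  obtain C where C: "C > 0" "\<And>s F. F \<in> borel_measurable (lborelP (b \<times> UNIV)) \<Longrightarrow>
    (\<integral>\<^sup>+z. F (\<lambda>j\<in>b \<times> UNIV. (\<Sum>i\<in>{1..4*n}. z i * of_rat (coeff j i)) + s j) \<partial>lborelP {1..4*n})
      = ennreal C * (\<integral>\<^sup>+w. F w \<partial>lborelP (b \<times> UNIV))"
    by blast
  have main: "(\<integral>\<^sup>+Z. (\<Prod>j\<in>b \<times> UNIV. F j (coord j Z)) \<partial>lborelP {1..4*n})
      = ennreal C * (\<Prod>j\<in>b \<times> UNIV. \<integral>\<^sup>+t. F j t \<partial>lborel)"
    if F: "\<And>j. j \<in> b \<times> UNIV \<Longrightarrow> F j \<in> borel_measurable borel" for F
  proof -
    have "(\<lambda>w. \<Prod>j\<in>b \<times> UNIV. F j (w j)) \<in> borel_measurable (lborelP (b \<times> UNIV))"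
    proof (intro borel_measurable_prod_ennreal)
      fix j assume "j \<in> b \<times> (UNIV :: 4 set)"
      then have "(\<lambda>w. w j) \<in> measurable (lborelP (b \<times> UNIV)) borel" by measurable
      from measurable_compose[OF this F] show "(\<lambda>w. F j (w j)) \<in> borel_measurable (lborelP (b \<times> UNIV))"
        using \<open>j \<in> b \<times> UNIV\<close> by simp
    qed
    from C(2)[OF this, of "\<lambda>_. 0"]
    have "(\<integral>\<^sup>+Z. (\<Prod>j\<in>b \<times> UNIV. F j (coord j Z)) \<partial>lborelP {1..4*n})
      = ennreal C * (\<integral>\<^sup>+w. (\<Prod>j\<in>b \<times> UNIV. F j (w j)) \<partial>lborelP (b \<times> UNIV))"
      by (simp add: coord_def)
    also have "(\<integral>\<^sup>+w. (\<Prod>j\<in>b \<times> UNIV. F j (w j)) \<partial>lborelP (b \<times> UNIV))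
      = (\<Prod>j\<in>b \<times> UNIV. \<integral>\<^sup>+t. F j t \<partial>lborel)"
      using fin F by (intro lborelP.product_nn_integral_prod) auto
    finally show ?thesis .
  qed
  show ?thesis
  proof (rule that[OF C(1)], intro allI impI main)
    show "F j \<in> borel_measurable borel" if "\<forall>j. F j \<in> borel_measurable borel" for F :: "_ \<Rightarrow> real \<Rightarrow> ennreal" and j
      using that by blast
  qed
qed

section \<open>The homogeneous integrand\<close>

definition quad :: "'e \<Rightarrow> (nat \<Rightarrow> real) \<Rightarrow> real" where
  "quad e Z = (\<Sum>a\<in>UNIV. (coord (e, a) Z)\<^sup>2)"

definition integrand :: "(nat \<Rightarrow> real) \<Rightarrow> ennreal" where
  "integrand Z = 1 / ennreal (\<Prod>e\<in>E. quad e Z)"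

lemma quad_nonneg [simp]: "quad e Z \<ge> 0"
  by (simp add: quad_def sum_nonneg)

lemma measurable_integrand [measurable]: "integrand \<in> borel_measurable (lborelP {1..4*n})"
  unfolding integrand_def[abs_def] quad_def[abs_def] by measurable

text \<open>Logarithmic divergence enters here: \<open>2 * n\<close> quadrics of degree 2 give
  degree \<open>- 4 * n\<close>, minus the dimension of the space. On the zero locus both sides are
  infinite.\<close>

lemma integrand_scale:
  assumes "t \<noteq> 0"
  shows "integrand (\<lambda>i\<in>{1..4*n}. t * Z i) = ennreal (inverse (\<bar>t\<bar> ^ (4*n))) * integrand Z"
proof -
  let ?P = "\<Prod>e\<in>E. quad e Z"
  have "quad e (\<lambda>i\<in>{1..4*n}. t * Z i) = t\<^sup>2 * quad e Z" for e
    by (simp add: quad_def coord_scale power_mult_distrib sum_distrib_left del: restrict_apply One_nat_def)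
  then have eq: "(\<Prod>e\<in>E. quad e (\<lambda>i\<in>{1..4*n}. t * Z i)) = \<bar>t\<bar> ^ (4*n) * ?P"
    by (simp add: prod.distrib card_E power_even_abs flip: power_mult del: restrict_apply One_nat_def)
  have P: "?P \<ge> 0" by (simp add: prod_nonneg)
  show ?thesis
  proof (cases "?P = 0")
    case True
    then show ?thesis
      unfolding integrand_def eq using assms by (simp add: ennreal_mult_top)
  next
    case False
    then have "?P > 0" using P by simp
    then show ?thesis
      unfolding integrand_def eq using assms
      by (simp add: divide_ennreal ennreal_mult[symmetric] field_simps flip: ennreal_1)
  qed
qed

lemma Max_coord_scale:
  fixes J :: "('e \<times> 4) set"
  assumes "finite J" "J \<noteq> {}" "t \<ge> 0"
  shows "Max ((\<lambda>j. \<bar>coord j (\<lambda>i\<in>{1..4*n}. t * Z i)\<bar>) ` J) = t * Max ((\<lambda>j. \<bar>coord j Z\<bar>) ` J)"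
proof -
  have "mono (\<lambda>x. t * x)" using assms by (simp add: mono_def mult_left_mono)
  from mono_Max_commute[OF this, of "(\<lambda>j. \<bar>coord j Z\<bar>) ` J"] show ?thesis
    using assms by (simp add: coord_scale abs_mult image_image del: restrict_apply One_nat_def)
qed

end

section \<open>Convergence and divergence of the chart integral\<close>

lemma prod_mono_ennreal:
  fixes f g :: "'a \<Rightarrow> ennreal"
  assumes "\<And>i. i \<in> A \<Longrightarrow> f i \<le> g i"
  shows "prod f A \<le> prod g A"
  using assms by (induction A rule: infinite_finite_induct) (auto intro: mult_mono)

context cycle_coordinates
begin

definition sup_coord :: "(nat \<Rightarrow> real) \<Rightarrow> real" where
  "sup_coord Z = Max ((\<lambda>j. \<bar>coord j Z\<bar>) ` (E \<times> UNIV))"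

text \<open>A quarter of the exponent \<open>4 - 2/n\<close> attached to a basis edge, one share for
  each of its four coordinates. Twice this number is the slope \<open>2 - 1/n\<close> of the rank
  inequality.\<close>

definition exponent :: real where
  "exponent = 1 - 1 / (2 * n)"

text \<open>Convergence of all nonempty proper subgraphs in terms of the complement
  \<open>F\<close>: the subgraph has \<open>2 * n - card F\<close> edges.\<close>

definition primitive_rank :: bool where
  "primitive_rank \<longleftrightarrow>
     (\<forall>F. F \<noteq> {} \<longrightarrow> F \<subset> E \<longrightarrow> card F + 2 * chain.dim (vanishing H F) < 2 * n)"

lemma finite_bases: "finite {b. edge_basis H b E}"
  by (rule finite_subset[of _ "Pow E"]) (auto simp: edge_basis_def finite_E)

lemma E_nonempty: "E \<noteq> {}"
  using card_E n by auto

text \<open>Under primitivity no edge functional vanishes identically, since that would give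
  \<open>1 + 2 * n < 2 * n\<close>; hence each edge alone is independent.\<close>

lemma edge_basis_through:
  assumes "primitive_rank" "e \<in> E"
  shows "\<exists>b. edge_basis H b E \<and> e \<in> b"
proof -
  \<comment> \<open>Parity: 1 is odd, \<open>2 * n\<close> is even. So a single edge is a proper
    subset also for \<open>n = 1\<close>.\<close>
  have "card {e} \<noteq> card E" unfolding card_E by simp
  then have "{e} \<subset> E" using assms(2) by (metis insert_subset empty_subsetI psubsetI)
  then have "1 + 2 * chain.dim (vanishing H {e}) < 2 * n"
    using assms(1)[unfolded primitive_rank_def, rule_format, of "{e}"] by simp
  moreover obtain b where b: "edge_basis H b {e}"
    using edge_basis_exists[of "{e}"] assms by auto
  ultimately have "b = {e}"
    using dim_H by (auto simp: edge_basis_def subset_singleton_iff)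
  then show ?thesis using extend_edge_basis[OF b] assms by auto
qed

text \<open>Strictness between integers leaves a gap of at least 1, and
  \<open>card b \<le> n\<close> lets \<open>card b / n\<close> be subtracted in its place.\<close>

lemma card_le_rank:
  assumes "primitive_rank" "F \<subset> E" "edge_basis H b F"
  shows "real (card F) \<le> 2 * exponent * card b"
proof (cases "F = {}")
  case False
  then have "card F + 2 * chain.dim (vanishing H F) < 2 * n"
    using assms by (auto simp: primitive_rank_def)
  moreover have b: "card b + chain.dim (vanishing H F) = n"
    using assms(3) dim_H by (metis edge_basis_def)
  ultimately have "card F + 1 \<le> 2 * card b" by simp
  then have "real (card F) + 1 \<le> 2 * card b" by linarith
  moreover have "card b / n \<le> 1" using b n by simp
  moreover have "2 * exponent * card b = 2 * card b - card b / n"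
    using n by (simp add: exponent_def field_simps)
  ultimately show ?thesis by linarith
qed (use assms n in \<open>auto simp: exponent_def edge_basis_def\<close>)

text \<open>A maximal basis of edges close to the zero locus dominates the integrand, with exponents
  that are each integrable.\<close>

lemma integrand_le:
  assumes prim: "primitive_rank" and Z: "1 / 2 \<le> sup_coord Z" "sup_coord Z \<le> 1"
  shows "integrand Z \<le> ennreal (2 ^ (4 * n)) *
    (\<Sum>b | edge_basis H b E. \<Prod>j\<in>b \<times> UNIV. cut_powr exponent (coord j Z))"
proof -
  let ?h = "\<lambda>j. cut_powr exponent (coord j Z)"
  \<comment> \<open>The size of an edge is the largest of its four coordinates; the quadric is at
    least its square.\<close>
  define L where "L e = Max (range (\<lambda>a. \<bar>coord (e, a) Z\<bar>))" for e
  have L_ge: "\<bar>coord (e, a) Z\<bar> \<le> L e" for e a by (simp add: L_def)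
  have "L e \<in> range (\<lambda>a. \<bar>coord (e, a) Z\<bar>)" for e
    unfolding L_def by (rule Max_in) auto
  then have L_eq: "\<exists>a. L e = \<bar>coord (e, a) Z\<bar>" for e by blast
  have L_le_sup: "L e \<le> sup_coord Z" if "e \<in> E" for e
    using L_eq[of e] that finite_E by (auto simp: sup_coord_def intro!: Max_ge)
  have "sup_coord Z \<in> (\<lambda>j. \<bar>coord j Z\<bar>) ` (E \<times> UNIV)"
    unfolding sup_coord_def using finite_E E_nonempty by (intro Max_in) auto
  \<comment> \<open>An edge of largest size. The slab confines this size to the interval from 1/2 to
    1.\<close>
  then obtain e0 where e0: "e0 \<in> E" "sup_coord Z \<le> L e0"
    using L_ge by auto
  have small: "\<bar>coord (e, a) Z\<bar> \<le> 1" if "e \<in> E" for e a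
    using L_ge[of e a] L_le_sup[OF that] Z by linarith
  have h_ge: "1 \<le> ?h (e, a)" if "e \<in> E" for e a
  proof (cases "coord (e, a) Z = 0")
    case False
    then have "1 powr - exponent \<le> \<bar>coord (e, a) Z\<bar> powr - exponent"
      using small[OF that] n by (intro powr_mono2') (auto simp: exponent_def)
    then show ?thesis using False small[OF that] by (simp add: cut_powr_def)
  qed (simp add: cut_powr_def)
  have sum_ge: "(\<Prod>j\<in>b \<times> UNIV. ?h j) \<le> (\<Sum>b | edge_basis H b E. \<Prod>j\<in>b \<times> UNIV. ?h j)"
    if "edge_basis H b E" for b
    using that finite_bases by (intro member_le_sum) auto
  show ?thesis
  proof (cases "\<exists>e\<in>E. L e = 0")
    case True
    then obtain e where e: "e \<in> E" "L e = 0" by blast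
    \<comment> \<open>On the zero locus the integrand is infinite, so the majorant must be infinite
      as well. A basis through \<open>e\<close> provides the infinite factor; the other factors are
      at least 1.\<close>
    obtain b where b: "edge_basis H b E" "e \<in> b" using edge_basis_through[OF prim e(1)] by blast
    note b' = edge_basis_E[OF b(1)]
    have "coord (e, 0) Z = 0" using L_ge[of e 0] e by simp
    then have top: "?h (e, 0) = \<infinity>" by (simp add: cut_powr_def)
    have "1 \<le> (\<Prod>j\<in>b \<times> UNIV - {(e, 0)}. ?h j)"
      using b' h_ge by (intro prod_ge_1) auto
    then have "(\<Prod>j\<in>b \<times> UNIV - {(e, 0)}. ?h j) \<noteq> 0" by (metis not_one_le_zero)
    moreover have "(\<Prod>j\<in>b \<times> UNIV. ?h j) = ?h (e, 0) * (\<Prod>j\<in>b \<times> UNIV - {(e, 0)}. ?h j)"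
      using b b' by (intro prod.remove) auto
    ultimately have "(\<Prod>j\<in>b \<times> UNIV. ?h j) = \<infinity>"
      unfolding top by (metis ennreal_top_mult infinity_ennreal_def)
    then have "(\<Sum>b | edge_basis H b E. \<Prod>j\<in>b \<times> UNIV. ?h j) = \<infinity>"
      using sum_ge[OF b(1)] by (simp add: top_unique)
    then show ?thesis by (simp add: ennreal_mult_top)
  next
    case False
    have L_pos: "L e > 0" if "e \<in> E" for e
      using False that L_ge[of e 0] by force
    \<comment> \<open>Logarithmic weights turn products into sums; small edges have large weight,
      and the slab gives \<open>0 \<le> a e0\<close> and \<open>a e0 \<le> ln 2\<close>.\<close>
    define a where "a e = - ln (L e)" for e
    have L_exp: "L e = exp (- a e)" if "e \<in> E" for e
      using L_pos[OF that] by (simp add: a_def)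
    have a_min: "a e0 \<le> a e" if "e \<in> E" for e
      using L_pos[OF that] L_pos[OF e0(1)] L_le_sup[OF that] e0(2) by (simp add: a_def)
    have "1 / 2 \<le> L e0" using Z e0 by linarith
    then have "ln (1 / 2) \<le> ln (L e0)" using L_pos[OF e0(1)] by (subst ln_le_cancel_iff) auto
    then have a0: "a e0 \<le> ln 2" by (simp add: a_def ln_div)
    have "ln (L e0) \<le> 0" using L_pos[OF e0(1)] L_le_sup[OF e0(1)] Z by simp
    then have a0': "0 \<le> a e0" by (simp add: a_def)
    have a_nonneg: "0 \<le> a e" if "e \<in> E" for e using a_min[OF that] a0' by linarith
    obtain S where S: "finite S" "H \<subseteq> chain.span S" using finite_dimensional by blast
    have exp0: "exponent \<ge> 0" using n by (simp add: exponent_def)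
    \<comment> \<open>The rank inequality holds only for proper subsets of \<open>E\<close>. Leaving
      out \<open>e0\<close> costs nothing, because its weight relative to the threshold
      \<open>a e0\<close> is 0.\<close>
    have "\<exists>b. edge_basis H b (E - {e0}) \<and>
      (\<forall>t. (\<forall>e\<in>E - {e0}. t \<le> a e) \<longrightarrow>
        (\<Sum>e\<in>E - {e0}. a e - t) \<le> 2 * exponent * (\<Sum>e\<in>b. a e - t))"
    proof (rule greedy_edge_basis[OF H S])
      show "finite (E - {e0})" using finite_E by simp
    next
      fix F' b assume "F' \<subseteq> E - {e0}" "edge_basis H b F'"
      then show "real (card F') \<le> 2 * exponent * card b"
        using e0 by (intro card_le_rank[OF prim]) auto
    qed
    then obtain b where b: "edge_basis H b (E - {e0})"
      "(\<Sum>e\<in>E - {e0}. a e - a e0) \<le> 2 * exponent * (\<Sum>e\<in>b. a e - a e0)"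
      using a_min by (metis Diff_iff)
    obtain b' where b': "b \<subseteq> b'" "edge_basis H b' E"
      using extend_edge_basis[OF b(1)] by auto
    note b'E = edge_basis_E[OF b'(2)]
    \<comment> \<open>Undoing the shift by \<open>a e0\<close> on all \<open>2 * n\<close> edges
      costs at most \<open>2 * n * ln 2\<close>, which becomes the constant
      \<open>2 ^ (4 * n)\<close> after doubling and exponentiating.\<close>
    have "(\<Sum>e\<in>E. a e) = (\<Sum>e\<in>E. a e - a e0) + 2 * n * a e0"
      by (simp add: sum_subtractf card_E)
    also have "(\<Sum>e\<in>E. a e - a e0) = (\<Sum>e\<in>E - {e0}. a e - a e0)"
      using finite_E e0 by (simp add: sum.remove)
    also have "\<dots> \<le> 2 * exponent * (\<Sum>e\<in>b. a e - a e0)" by (rule b)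
    also have "(\<Sum>e\<in>b. a e - a e0) \<le> (\<Sum>e\<in>b. a e)"
      using a0' by (intro sum_mono) simp
    also have "(\<Sum>e\<in>b. a e) \<le> (\<Sum>e\<in>b'. a e)"
      using b' b'E a_nonneg by (intro sum_mono2) auto
    also have "2 * n * a e0 \<le> 2 * n * ln 2"
      using a0 n by (intro mult_left_mono) auto
    finally have key: "(\<Sum>e\<in>E. a e) \<le> 2 * exponent * (\<Sum>e\<in>b'. a e) + 2 * n * ln 2"
      using exp0 by (simp add: mult_left_mono)
    have h_ge_exp: "ennreal (exp (exponent * a e)) \<le> ?h (e, c)" if "e \<in> E" for e c
    proof (cases "coord (e, c) Z = 0")
      case False
      have "exp (exponent * a e) = L e powr (- exponent)"
        using L_pos[OF that] by (simp add: powr_def a_def)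
      also have "\<dots> \<le> \<bar>coord (e, c) Z\<bar> powr (- exponent)"
        using False L_ge exp0 by (intro powr_mono2') auto
      finally show ?thesis
        using False small[OF that] by (simp add: cut_powr_def ennreal_leI)
    qed (simp add: cut_powr_def)
    have quad_ge: "exp (- 2 * a e) \<le> quad e Z" if "e \<in> E" for e
    proof -
      obtain c where c: "L e = \<bar>coord (e, c) Z\<bar>" using L_eq by blast
      have "exp (- 2 * a e) = (L e)\<^sup>2"
        using L_exp[OF that] by (simp add: power2_eq_square flip: exp_add)
      also have "\<dots> = (coord (e, c) Z)\<^sup>2" using c by simp
      also have "\<dots> \<le> quad e Z"
        unfolding quad_def by (intro member_le_sum) auto
      finally show ?thesis .
    qed
    have "exp (- 2 * (\<Sum>e\<in>E. a e)) = (\<Prod>e\<in>E. exp (- 2 * a e))"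
      by (simp add: exp_sum[OF finite_E] sum_distrib_left flip: sum_negf)
    also have "\<dots> \<le> (\<Prod>e\<in>E. quad e Z)"
      using quad_ge by (intro prod_mono) auto
    finally have P: "exp (- 2 * (\<Sum>e\<in>E. a e)) \<le> (\<Prod>e\<in>E. quad e Z)" .
    then have "0 < (\<Prod>e\<in>E. quad e Z)" by (rule less_le_trans[rotated]) simp
    then have "integrand Z = ennreal (1 / (\<Prod>e\<in>E. quad e Z))"
      by (simp add: integrand_def divide_ennreal flip: ennreal_1)
    also have "\<dots> \<le> ennreal (exp (2 * (\<Sum>e\<in>E. a e)))"
      using P \<open>0 < (\<Prod>e\<in>E. quad e Z)\<close> by (intro ennreal_leI) (simp add: field_simps exp_minus)
    also have "\<dots> \<le> ennreal (exp (4 * n * ln 2 + 4 * exponent * (\<Sum>e\<in>b'. a e)))"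
      using key by (intro ennreal_leI) simp
    also have "\<dots> = ennreal (2 ^ (4 * n)) * ennreal (exp (4 * exponent * (\<Sum>e\<in>b'. a e)))"
    proof -
      have "exp (4 * n * ln 2) = (2 :: real) ^ (4 * n)"
        using exp_of_nat_mult[of "4 * n" "ln 2 :: real"] by simp
      then show ?thesis by (simp add: exp_add ennreal_mult)
    qed
    also have "exp (4 * exponent * (\<Sum>e\<in>b'. a e)) = (\<Prod>j\<in>b' \<times> (UNIV :: 4 set). exp (exponent * a (fst j)))"
    proof -
      have "(\<Sum>j\<in>b' \<times> (UNIV :: 4 set). exponent * a (fst j)) = (\<Sum>e\<in>b'. 4 * exponent * a e)"
        by (simp add: sum.cartesian_product' mult_ac)
      also have "\<dots> = 4 * exponent * (\<Sum>e\<in>b'. a e)" by (simp add: sum_distrib_left)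
      finally show ?thesis using b'E by (simp flip: exp_sum)
    qed
    also have "ennreal \<dots> = (\<Prod>j\<in>b' \<times> (UNIV :: 4 set). ennreal (exp (exponent * a (fst j))))"
      by (simp only: prod_ennreal exp_ge_zero)
    also have "\<dots> \<le> (\<Prod>j\<in>b' \<times> UNIV. ?h j)"
      using h_ge_exp b'E by (intro prod_mono_ennreal) auto
    also have "\<dots> \<le> (\<Sum>b | edge_basis H b E. \<Prod>j\<in>b \<times> UNIV. ?h j)"
      by (rule sum_ge[OF b'(2)])
    finally show ?thesis by (simp add: mult_left_mono)
  qed
qed

lemma insert_interval: "{1..4*n} = insert 1 {2..4*n}" "(1::nat) \<notin> {2..4*n}"
    "Suc (card {2..4*n}) = 4 * n"
  using n by auto

text \<open>All edge coordinates together are injective on real points, and a chart point is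
  nonzero.\<close>

lemma sup_coord_pos: "sup_coord (x(1 := 1)) > 0"
proof (rule ccontr)
  assume *: "\<not> ?thesis"
  have le: "\<bar>coord j (x(1 := 1))\<bar> \<le> sup_coord (x(1 := 1))" if "j \<in> E \<times> UNIV" for j
    unfolding sup_coord_def using that finite_E by (intro Max_ge) auto
  have zero: "coord j (x(1 := 1)) = 0" if "j \<in> E \<times> UNIV" for j
    using le[OF that] * by linarith
  have "(x(1 := 1)) 1 = (0 :: real)"
  proof (rule trivial_kernel_real[OF finite_atLeastAtMost trivial_kernel_coeff[OF vanishing_E],
        where v = "x(1 := 1)" and i = 1])
    show "(\<Sum>i\<in>{1..4*n}. (x(1 := 1)) i * real_of_rat (coeff j i)) = 0" if "j \<in> E \<times> UNIV" for j
      using zero[OF that] unfolding coord_def .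
    show "1 \<in> {1..4*n}" using n by simp
  qed
  then show False by simp
qed

text \<open>The slab bounds the chart integral, \<open>integrand_le\<close> bounds the slab
  integral, and each term of the majorant factors into one-dimensional integrals with
  \<open>exponent < 1\<close>.\<close>

lemma chart_finite:
  assumes "primitive_rank"
  shows "(\<integral>\<^sup>+x. integrand (x(1 := 1)) \<partial>lborelP {2..4*n}) < \<infinity>"
proof -
  have meas: "sup_coord \<in> borel_measurable (lborelP {1..4*n})"
    unfolding sup_coord_def[abs_def] using finite_E
    by (intro borel_measurable_Max borel_measurable_abs measurable_coord) auto
  have slab: "(\<integral>\<^sup>+x. integrand (x(1 := 1)) \<partial>lborelP {2..4*n})
    \<le> 2 * (\<integral>\<^sup>+Z. integrand Z * slab sup_coord Z \<partial>lborelP (insert 1 {2..4*n}))"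
  proof (rule nn_integral_chart_le_slab)
    show "integrand (\<lambda>i\<in>insert 1 {2..4*n}. t * z i) =
      ennreal (inverse (\<bar>t\<bar> ^ Suc (card {2..4*n}))) * integrand z" if "t \<noteq> 0" for t z
      unfolding insert_interval(1)[symmetric] insert_interval(3) by (rule integrand_scale[OF that])
    show "sup_coord (\<lambda>i\<in>insert 1 {2..4*n}. t * z i) = t * sup_coord z" if "t \<ge> 0" for t z
      unfolding sup_coord_def insert_interval(1)[symmetric]
      using that finite_E E_nonempty by (intro Max_coord_scale) auto
    show "sup_coord \<in> borel_measurable (lborelP (insert 1 {2..4*n}))"
      "integrand \<in> borel_measurable (lborelP (insert 1 {2..4*n}))"
      unfolding insert_interval(1)[symmetric] by (rule meas, rule measurable_integrand)
  qed (simp, simp, rule sup_coord_pos)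
  have "(\<integral>\<^sup>+Z. integrand Z * slab sup_coord Z \<partial>lborelP (insert 1 {2..4*n})) \<le>
    (\<integral>\<^sup>+Z. ennreal (2 ^ (4 * n)) *
      (\<Sum>b | edge_basis H b E. \<Prod>j\<in>b \<times> UNIV. cut_powr exponent (coord j Z)) \<partial>lborelP {1..4*n})"
    unfolding insert_interval(1)[symmetric]
    using integrand_le[OF assms] by (intro nn_integral_mono) (auto simp: slab_def indicator_def)
  also have "\<dots> = ennreal (2 ^ (4 * n)) * (\<Sum>b | edge_basis H b E.
      (\<integral>\<^sup>+Z. (\<Prod>j\<in>b \<times> UNIV. cut_powr exponent (coord j Z)) \<partial>lborelP {1..4*n}))"
    by (subst nn_integral_cmult, measurable, subst nn_integral_sum, measurable)
  also have "\<dots> < \<infinity>"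
  proof -
    have "(\<integral>\<^sup>+Z. (\<Prod>j\<in>b \<times> UNIV. cut_powr exponent (coord j Z)) \<partial>lborelP {1..4*n}) < \<infinity>"
      if b: "edge_basis H b E" for b
    proof -
      obtain C where "C > 0" and C: "\<forall>F. (\<forall>j. F j \<in> borel_measurable borel) \<longrightarrow>
        (\<integral>\<^sup>+Z. (\<Prod>j\<in>b \<times> UNIV. F j (coord j Z)) \<partial>lborelP {1..4*n})
          = ennreal C * (\<Prod>j\<in>b \<times> UNIV. \<integral>\<^sup>+t. F j t \<partial>lborel)"
        by (rule change_of_coords[OF b])
      have "(\<integral>\<^sup>+Z. (\<Prod>j\<in>b \<times> UNIV. cut_powr exponent (coord j Z)) \<partial>lborelP {1..4*n})
        = ennreal C * (\<Prod>j\<in>b \<times> (UNIV :: 4 set). \<integral>\<^sup>+t. cut_powr exponent t \<partial>lborel)"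
        by (intro C[rule_format] measurable_cut_powr)
      moreover have "(\<integral>\<^sup>+t. cut_powr exponent t \<partial>lborel) < \<infinity>"
        using n by (intro nn_integral_cut_powr_finite) (simp add: exponent_def)
      ultimately show ?thesis
        by (simp add: ennreal_mult_less_top power_less_top_ennreal)
    qed
    then show ?thesis
      using finite_bases by (auto simp: ennreal_mult_less_top)
  qed
  finally show ?thesis
    by (intro le_less_trans[OF slab]) (simp add: ennreal_mult_less_top)
qed

end

section \<open>Divergence along dyadic shells\<close>

lemma suminf_const_ennreal:
  assumes "c > 0"
  shows "(\<Sum>k :: nat. ennreal c) = \<infinity>"
proof (rule ccontr)
  assume "\<not> ?thesis"
  then obtain u where u: "(\<Sum>k :: nat. ennreal c) = ennreal u" "u \<ge> 0"
    by (metis ennreal_cases infinity_ennreal_def)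
  obtain N where N: "u < real N * c"
    using ex_less_of_nat_mult[OF assms] by blast
  have "(\<Sum>k<N. ennreal c) \<le> (\<Sum>k. ennreal c)"
    by (rule sum_le_suminf) auto
  then have "(\<Sum>k<N. c) \<le> u"
    using u assms by (simp add: sum_ennreal del: sum_constant)
  then show False using N by simp
qed

lemma le_divide_ennreal:
  assumes "0 \<le> x" "x \<le> u" "0 < u"
  shows "ennreal (1 / u) \<le> 1 / ennreal x"
proof (cases "x = 0")
  case False
  then show ?thesis
    using assms by (simp add: divide_ennreal frac_le flip: ennreal_1)
qed simp

context cycle_coordinates
begin

lemma coord_bound:
  assumes "\<And>c. c \<in> H \<Longrightarrow> c e = (\<Sum>x\<in>b. \<gamma> x * c x)"
    and "\<And>x. x \<in> b \<Longrightarrow> \<bar>coord (x, a) Z\<bar> \<le> \<rho>" and "(\<Sum>x\<in>b. \<bar>real_of_rat (\<gamma> x)\<bar>) \<le> D" "\<rho> \<ge> 0"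
  shows "\<bar>coord (e, a) Z\<bar> \<le> D * \<rho>"
proof -
  have "coord (e, a) Z = (\<Sum>x\<in>b. real_of_rat (\<gamma> x) * coord (x, a) Z)"
    using assms(1) by (rule coord_combination)
  then have "\<bar>coord (e, a) Z\<bar> \<le> (\<Sum>x\<in>b. \<bar>real_of_rat (\<gamma> x) * coord (x, a) Z\<bar>)"
    by (simp only: sum_abs)
  also have "\<dots> \<le> (\<Sum>x\<in>b. \<bar>real_of_rat (\<gamma> x)\<bar> * \<rho>)"
    using assms(2) by (intro sum_mono) (simp add: abs_mult mult_left_mono)
  also have "\<dots> \<le> D * \<rho>"
    using assms(3,4) by (simp add: mult_right_mono flip: sum_distrib_right)
  finally show ?thesis .
qed

lemma quad_bound:
  assumes "\<And>a. \<bar>coord (e, a) Z\<bar> \<le> u"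
  shows "quad e Z \<le> 4 * u\<^sup>2"
proof -
  have "(coord (e, a) Z)\<^sup>2 \<le> u\<^sup>2" for a
    using assms[of a] by (simp add: abs_le_square_iff[symmetric])
  then have "quad e Z \<le> (\<Sum>a\<in>(UNIV :: 4 set). u\<^sup>2)"
    unfolding quad_def by (rule sum_mono)
  then show ?thesis by simp
qed

text \<open>Functionals in \<open>F\<close> are fixed combinations of those in \<open>b\<close>, so
  \<open>D\<close> is uniform in \<open>Z\<close> and \<open>\<rho>\<close>. For empty
  \<open>b\<close> one may take \<open>\<rho> = 0\<close>, which forces the quadrics to
  vanish.\<close>

lemma edge_bound:
  assumes "edge_basis H b F" "F \<subseteq> E"
  shows "\<exists>D>0. \<forall>Z \<rho>. \<rho> \<ge> 0 \<longrightarrow> (\<forall>x\<in>b. \<forall>a. \<bar>coord (x, a) Z\<bar> \<le> \<rho>) \<longrightarrow>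
    (\<forall>e\<in>F. quad e Z \<le> D * \<rho>\<^sup>2)"
proof -
  have "b \<subseteq> F" using assms(1) by (simp add: edge_basis_def)
  with assms(2) finite_E have fin: "finite F" "finite b"
    by (meson finite_subset)+
  have "\<exists>\<gamma>. \<forall>c\<in>H. c e = (\<Sum>x\<in>b. \<gamma> x * c x)" if "e \<in> F" for e
    using assms that fin H by (intro vanishing_combination) (auto simp: edge_basis_def vanishing_def)
  then obtain \<gamma> where \<gamma>: "\<And>e c. e \<in> F \<Longrightarrow> c \<in> H \<Longrightarrow> c e = (\<Sum>x\<in>b. \<gamma> e x * c x)"
    by metis
  define D where "D = 1 + (\<Sum>e\<in>F. \<Sum>x\<in>b. \<bar>real_of_rat (\<gamma> e x)\<bar>)"
  have D1: "(\<Sum>x\<in>b. \<bar>real_of_rat (\<gamma> e x)\<bar>) \<le> D" if "e \<in> F" for e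
  proof -
    have "(\<Sum>x\<in>b. \<bar>real_of_rat (\<gamma> e x)\<bar>) \<le> (\<Sum>e\<in>F. \<Sum>x\<in>b. \<bar>real_of_rat (\<gamma> e x)\<bar>)"
      using that fin by (intro member_le_sum) (auto simp: sum_nonneg)
    then show ?thesis by (simp add: D_def)
  qed
  have "D \<ge> 1" by (simp add: D_def sum_nonneg)
  have "quad e Z \<le> 4 * D\<^sup>2 * \<rho>\<^sup>2"
    if "e \<in> F" "\<rho> \<ge> 0" "\<forall>x\<in>b. \<forall>a. \<bar>coord (x, a) Z\<bar> \<le> \<rho>" for e Z \<rho>
  proof -
    have "quad e Z \<le> 4 * (D * \<rho>)\<^sup>2"
      using that by (intro quad_bound coord_bound[OF \<gamma>[OF that(1)] _ D1[OF that(1)]]) auto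
    then show ?thesis by (simp add: power_mult_distrib)
  qed
  then show ?thesis using \<open>D \<ge> 1\<close> by (intro exI[of _ "4 * D\<^sup>2"]) auto
qed

text \<open>The boxes \<open>shell b\<^sub>1 k\<close> approach the zero locus of the functionals in \<open>b\<^sub>1\<close> dyadically.\<close>

definition shell :: "'e set \<Rightarrow> nat \<Rightarrow> 'e \<times> 4 \<Rightarrow> real set" where
  "shell b1 k j = (if fst j \<in> b1 then {1 / 2 ^ Suc k<..1 / 2 ^ k} else {1/2..1})"

lemma shell_bounds:
  assumes "t \<in> shell b1 k j"
  shows "\<bar>t\<bar> \<le> 1" "fst j \<in> b1 \<Longrightarrow> \<bar>t\<bar> \<le> 1 / 2 ^ k"
proof -
  have pow: "(0 :: real) < 1 / 2 ^ Suc k" "1 / 2 ^ k \<le> (1 :: real)" by (simp_all add: divide_le_eq)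
  have "1 / 2 ^ Suc k < t \<and> t \<le> 1 / 2 ^ k" if "fst j \<in> b1"
    using assms that by (simp add: shell_def)
  then show le: "\<bar>t\<bar> \<le> 1 / 2 ^ k" if "fst j \<in> b1"
    using pow that by linarith
  show "\<bar>t\<bar> \<le> 1"
  proof (cases "fst j \<in> b1")
    case True
    then show ?thesis using le pow by linarith
  next
    case False
    then show ?thesis using assms by (simp add: shell_def)
  qed
qed

text \<open>The lower end of each dyadic interval is excluded, so neighbouring intervals share no
  endpoint.\<close>

lemma shell_unique:
  assumes "t \<in> shell b1 k j" "t \<in> shell b1 l j" "fst j \<in> b1"
  shows "k = l"
proof -
  have "\<not> k < l" if "t \<in> shell b1 k j" "t \<in> shell b1 l j" for k l
  proof
    assume "k < l"
    then have "(1 :: real) / 2 ^ l \<le> 1 / 2 ^ Suc k"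
      by (intro divide_left_mono power_increasing) auto
    then show False using that assms(3) by (auto simp: shell_def)
  qed
  from this[OF assms(1,2)] this[OF assms(2,1)] show ?thesis by simp
qed

lemma emeasure_shell:
  "emeasure lborel (shell b1 k j) = ennreal ((if fst j \<in> b1 then 1 / 2 ^ k else 1) / 2)"
proof -
  have "1 / 2 ^ k - 1 / 2 ^ Suc k = (1 / 2 ^ k / 2 :: real)" by (simp add: field_simps)
  moreover have "(1 :: real) / 2 ^ Suc k \<le> 1 / 2 ^ k"
    by (intro divide_left_mono power_increasing) auto
  ultimately show ?thesis by (simp add: shell_def)
qed

text \<open>On shell \<open>k\<close> the quadrics of \<open>F\<close> are of order at most
  \<open>(1 / 2 ^ k)\<^sup>2\<close> and the others are bounded. The resulting growth matches the
  inverse volume of the shell, which shrinks in \<open>4 * card b1\<close> directions.\<close>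

lemma integrand_ge:
  assumes b1: "edge_basis H b1 F" and b: "edge_basis H b E" "b1 \<subseteq> b"
    and F: "F \<subseteq> E" "2 * card b1 \<le> card F"
  shows "\<exists>D>0. \<forall>Z k. (\<forall>j\<in>b \<times> UNIV. coord j Z \<in> shell b1 k j) \<longrightarrow>
    ennreal (D * (2 ^ k) ^ (4 * card b1)) \<le> integrand Z"
proof -
  obtain D1 where D1: "D1 > 0" "\<And>Z \<rho> e. \<rho> \<ge> 0 \<Longrightarrow> \<forall>x\<in>b1. \<forall>a. \<bar>coord (x, a) Z\<bar> \<le> \<rho> \<Longrightarrow> e \<in> F \<Longrightarrow>
      quad e Z \<le> D1 * \<rho>\<^sup>2"
    using edge_bound[OF b1 F(1)] by metis
  obtain D2 where D2: "D2 > 0" "\<And>Z \<rho> e. \<rho> \<ge> 0 \<Longrightarrow> \<forall>x\<in>b. \<forall>a. \<bar>coord (x, a) Z\<bar> \<le> \<rho> \<Longrightarrow> e \<in> E \<Longrightarrow>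
      quad e Z \<le> D2 * \<rho>\<^sup>2"
    using edge_bound[OF b(1) order_refl] by metis
  define D where "D = D1 ^ card F * D2 ^ card (E - F)"
  have D: "D > 0" using D1 D2 by (simp add: D_def)
  have "ennreal (1 / D * (2 ^ k) ^ (4 * card b1)) \<le> integrand Z"
    if Z: "\<forall>j\<in>b \<times> UNIV. coord j Z \<in> shell b1 k j" for Z k
  proof -
    have F_le: "quad e Z \<le> D1 * (1 / 2 ^ k)\<^sup>2" if "e \<in> F" for e
      using Z b(2) that by (intro D1(2)) (auto intro!: shell_bounds(2))
    have E_le: "quad e Z \<le> D2 * 1\<^sup>2" if "e \<in> E" for e
      using Z that by (intro D2(2)) (auto intro!: shell_bounds(1))
    have "(\<Prod>e\<in>E. quad e Z) = (\<Prod>e\<in>F. quad e Z) * (\<Prod>e\<in>E - F. quad e Z)"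
      using prod.subset_diff[OF F(1) finite_E] by (simp add: mult.commute)
    also have "\<dots> \<le> (\<Prod>e\<in>F. D1 * (1 / 2 ^ k)\<^sup>2) * (\<Prod>e\<in>E - F. D2 * 1\<^sup>2)"
      using F_le E_le D1(1) D2(1) by (intro mult_mono prod_mono prod_nonneg) auto
    also have "\<dots> = D * ((1 / 2 ^ k)\<^sup>2) ^ card F"
      by (simp add: D_def power_mult_distrib mult_ac)
    also have "((1 / 2 ^ k)\<^sup>2) ^ card F = (1 / 2 ^ k :: real) ^ (2 * card F)"
      by (rule power_mult[symmetric])
    \<comment> \<open>The base is at most 1, and this is where
      \<open>2 * card b1 \<le> card F\<close> is used.\<close>
    also have "D * (1 / 2 ^ k) ^ (2 * card F) \<le> D * (1 / 2 ^ k) ^ (4 * card b1)"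
      using D F(2) by (intro mult_left_mono power_decreasing) (auto simp: divide_le_eq)
    finally have "(\<Prod>e\<in>E. quad e Z) \<le> D * (1 / 2 ^ k) ^ (4 * card b1)" .
    from le_divide_ennreal[OF _ this] show ?thesis
      using D by (simp add: integrand_def prod_nonneg power_one_over)
  qed
  then show ?thesis using D by (intro exI[of _ "1 / D"]) auto
qed

text \<open>The growth bound times the volume is the same positive constant on every shell, and the
  shells are disjoint unless \<open>b1\<close> is empty.\<close>

lemma chart_infinite:
  assumes F: "F \<noteq> {}" "F \<subset> E" "2 * n \<le> card F + 2 * chain.dim (vanishing H F)"
  shows "(\<integral>\<^sup>+x. integrand (x(1 := 1)) \<partial>lborelP {2..4*n}) = \<infinity>"
proof -
  obtain b1 where b1: "edge_basis H b1 F" using edge_basis_exists F(2) by blast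
  obtain b where b: "b1 \<subseteq> b" "edge_basis H b E" using extend_edge_basis[OF b1] F(2) by blast
  note bE = edge_basis_E[OF b(2)]
  define r where "r = card b1"
  have dim: "r + chain.dim (vanishing H F) = n"
    using b1 dim_H by (metis edge_basis_def r_def)
  then have r: "2 * r \<le> card F" using F(3) by simp
  \<comment> \<open>Properness of \<open>F\<close> leaves a basis edge \<open>p\<close> outside
    \<open>b1\<close>. Its coordinate stays between 1/2 and 1 on all shells, so it can serve as the
    linear function defining the slab.\<close>
  have "card F < 2 * n" using psubset_card_mono[OF finite_E F(2)] card_E by simp
  then have "r < n" using r by simp
  then have "b1 \<noteq> b" using bE by (auto simp: r_def)
  then obtain p where p: "p \<in> b" "p \<notin> b1" using b(1) by blast
  obtain D where D: "D > 0" and ge: "\<And>Z k. \<forall>j\<in>b \<times> UNIV. coord j Z \<in> shell b1 k j \<Longrightarrow>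
    ennreal (D * (2 ^ k) ^ (4 * r)) \<le> integrand Z"
    using integrand_ge[OF b1 b(2,1) _ r[unfolded r_def]] F(2) unfolding r_def by (metis psubset_imp_subset)
  define box where "box k Z = (\<Prod>j\<in>b \<times> UNIV. indicator (shell b1 k j) (coord j Z) :: ennreal)" for k Z
  have box: "box k Z = (if \<forall>j\<in>b \<times> UNIV. coord j Z \<in> shell b1 k j then 1 else 0)" for k Z
    using bE by (auto simp: box_def indicator_def intro!: prod.neutral)
  have pointwise: "(\<Sum>k. ennreal (D * (2 ^ k) ^ (4 * r)) * box k Z) \<le> integrand Z * slab (coord (p, 0)) Z" for Z
  proof (cases "\<exists>k. \<forall>j\<in>b \<times> UNIV. coord j Z \<in> shell b1 k j")
    case False
    then have "box k Z = 0" for k unfolding box by metis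
    then show ?thesis by simp
  next
    case True
    then obtain k where k: "\<forall>j\<in>b \<times> UNIV. coord j Z \<in> shell b1 k j" by blast
    then have "coord (p, 0) Z \<in> {1/2..1}" using p by (force simp: shell_def)
    then have slab: "slab (coord (p, 0)) Z = 1" by (simp add: slab_def)
    show ?thesis
    \<comment> \<open>If \<open>b1\<close> is empty, all boxes coincide and disjointness fails; but
      then the functionals in \<open>F\<close> vanish identically and the integrand is
      infinite.\<close>
    proof (cases "b1 = {}")
      case True
      obtain e where e: "e \<in> F" using F(1) by blast
      have "quad e Z = 0"
      proof -
        obtain D' where "\<forall>Z \<rho>. \<rho> \<ge> 0 \<longrightarrow> (\<forall>x\<in>b1. \<forall>a. \<bar>coord (x, a) Z\<bar> \<le> \<rho>) \<longrightarrow>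
          (\<forall>e\<in>F. quad e Z \<le> D' * \<rho>\<^sup>2)"
          using edge_bound[OF b1] F(2) by blast
        from this[rule_format, of 0 Z e] show ?thesis
          using True e quad_nonneg[of e Z] by simp
      qed
      then have "(\<Prod>e\<in>E. quad e Z) = 0"
        using e F(2) finite_E by (intro prod_zero) auto
      then show ?thesis using slab by (simp add: integrand_def)
    next
      case False
      then obtain x where x: "x \<in> b1" by blast
      have "box l Z = 0" if "l \<noteq> k" for l
      proof -
        have "coord (x, 0) Z \<notin> shell b1 l (x, 0)"
          using shell_unique[of "coord (x, 0) Z" b1 k "(x, 0)" l] k x b(1) that by auto
        then show ?thesis using x b(1) unfolding box by auto
      qed
      then have "(\<Sum>k. ennreal (D * (2 ^ k) ^ (4 * r)) * box k Z) = ennreal (D * (2 ^ k) ^ (4 * r)) * box k Z"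
        by (subst suminf_finite[of "{k}"]) auto
      also have "\<dots> \<le> integrand Z * slab (coord (p, 0)) Z"
        using ge[OF k] slab by (simp add: box k)
      finally show ?thesis .
    qed
  qed
  obtain C where C: "C > 0" and cov: "\<forall>F. (\<forall>j. F j \<in> borel_measurable borel) \<longrightarrow>
    (\<integral>\<^sup>+Z. (\<Prod>j\<in>b \<times> UNIV. F j (coord j Z)) \<partial>lborelP {1..4*n})
      = ennreal C * (\<Prod>j\<in>b \<times> UNIV. \<integral>\<^sup>+t. F j t \<partial>lborel)"
    by (rule change_of_coords[OF b(2)])
  have shell_sets [measurable]: "shell b1 k j \<in> sets borel" for k j
    by (simp add: shell_def)
  have box_meas [measurable]: "box k \<in> borel_measurable (lborelP {1..4*n})" for k
    unfolding box_def[abs_def]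
    by (intro borel_measurable_prod_ennreal measurable_compose[OF measurable_coord]) measurable
  \<comment> \<open>The box has \<open>4 * r\<close> sides of length \<open>1 / 2 ^ k / 2\<close>;
    the remaining sides have length 1/2.\<close>
  have int_box: "(\<integral>\<^sup>+Z. box k Z \<partial>lborelP {1..4*n}) = ennreal (C * ((1 / 2 ^ k) ^ (4 * r) * (1 / 2) ^ (4 * n)))" for k
  proof -
    have "(\<integral>\<^sup>+Z. box k Z \<partial>lborelP {1..4*n}) = ennreal C * (\<Prod>j\<in>b \<times> (UNIV :: 4 set). emeasure lborel (shell b1 k j))"
      using cov[rule_format, of "\<lambda>j t. indicator (shell b1 k j) t"] by (simp add: box_def)
    also have "(\<Prod>j\<in>b \<times> (UNIV :: 4 set). emeasure lborel (shell b1 k j)) =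
      ennreal (\<Prod>j\<in>b \<times> (UNIV :: 4 set). (if fst j \<in> b1 then 1 / 2 ^ k else 1) * (1 / 2))"
      by (simp add: emeasure_shell prod_ennreal)
    also have "(\<Prod>j\<in>b \<times> (UNIV :: 4 set). (if fst j \<in> b1 then 1 / 2 ^ k else 1) * (1 / 2 :: real))
      = (\<Prod>j\<in>b \<times> (UNIV :: 4 set). if fst j \<in> b1 then 1 / 2 ^ k else 1) * (1 / 2) ^ (4 * n)"
      using bE by (simp only: prod.distrib prod_constant card_cartesian_product) (simp add: mult.commute)
    also have "(\<Prod>j\<in>b \<times> (UNIV :: 4 set). if fst j \<in> b1 then 1 / 2 ^ k else 1)
      = (\<Prod>j\<in>b1 \<times> (UNIV :: 4 set). 1 / 2 ^ k :: real)"
      using b(1) bE by (intro prod.mono_neutral_cong_right) auto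
    also have "\<dots> = (1 / 2 ^ k) ^ (4 * r)"
      by (simp add: card_cartesian_product r_def mult.commute)
    finally show ?thesis using C by (simp add: ennreal_mult)
  qed
  have "\<infinity> = (\<Sum>k :: nat. ennreal (D * C * (1 / 2) ^ (4 * n)))"
    using C D by (intro suminf_const_ennreal[symmetric]) simp
  also have "\<dots> = (\<Sum>k. ennreal (D * (2 ^ k) ^ (4 * r)) * (\<integral>\<^sup>+Z. box k Z \<partial>lborelP {1..4*n}))"
  proof (rule arg_cong[where f = suminf], rule ext)
    fix k :: nat
    have "(2 ^ k) ^ (4 * r) * (1 / 2 ^ k) ^ (4 * r) = (1 :: real)"
      by (simp flip: power_mult_distrib)
    then have "D * C * (1 / 2) ^ (4 * n) = D * (2 ^ k) ^ (4 * r) * (C * ((1 / 2 ^ k) ^ (4 * r) * (1 / 2) ^ (4 * n)))"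
      by (simp add: field_simps)
    then show "ennreal (D * C * (1 / 2) ^ (4 * n)) = ennreal (D * (2 ^ k) ^ (4 * r)) * (\<integral>\<^sup>+Z. box k Z \<partial>lborelP {1..4*n})"
      unfolding int_box using C D by (simp only:) (rule ennreal_mult, auto)
  qed
  also have "\<dots> = (\<Sum>k. \<integral>\<^sup>+Z. ennreal (D * (2 ^ k) ^ (4 * r)) * box k Z \<partial>lborelP {1..4*n})"
    by (subst nn_integral_cmult) measurable
  also have "\<dots> = (\<integral>\<^sup>+Z. (\<Sum>k. ennreal (D * (2 ^ k) ^ (4 * r)) * box k Z) \<partial>lborelP {1..4*n})"
    by (rule nn_integral_suminf[symmetric]) measurable
  also have "\<dots> \<le> (\<integral>\<^sup>+Z. integrand Z * slab (coord (p, 0)) Z \<partial>lborelP {1..4*n})"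
    by (intro nn_integral_mono pointwise)
  also have "\<dots> = (\<integral>\<^sup>+Z. integrand Z * slab (coord (p, 0)) Z \<partial>lborelP (insert 1 {2..4*n}))"
    by (simp only: insert_interval(1))
  also have "\<dots> \<le> (\<integral>\<^sup>+x. integrand (x(1 := 1)) \<partial>lborelP {2..4*n})"
  proof (rule nn_integral_slab_le_chart)
    show "integrand (\<lambda>i\<in>insert 1 {2..4*n}. t * z i) =
      ennreal (inverse (\<bar>t\<bar> ^ Suc (card {2..4*n}))) * integrand z" if "t \<noteq> 0" for t z
      unfolding insert_interval(1)[symmetric] insert_interval(3) by (rule integrand_scale[OF that])
    show "coord (p, 0) (\<lambda>i\<in>insert 1 {2..4*n}. t * z i) = t * coord (p, 0) z" for t z
      unfolding insert_interval(1)[symmetric] by (rule coord_scale)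
    show "coord (p, 0) \<in> borel_measurable (lborelP (insert 1 {2..4*n}))"
      "integrand \<in> borel_measurable (lborelP (insert 1 {2..4*n}))"
      unfolding insert_interval(1)[symmetric] by (rule measurable_coord, rule measurable_integrand)
  qed simp_all
  finally show ?thesis by (simp add: top_unique)
qed

end

section \<open>Cycle spaces of subgraphs\<close>

lemma boundary_add: "boundary G (c + d) v = boundary G c v + boundary G d v"
  by (simp add: boundary_def sum.distrib)

lemma boundary_scale: "boundary G (chain_scale r c) v = r * boundary G c v"
  by (simp add: boundary_def chain_scale_def sum_distrib_left right_diff_distrib)

lemma subspace_H1: "chain.subspace (H1 G)"
  unfolding chain.subspace_def H1_def
  by (auto simp: boundary_add boundary_scale) (auto simp: boundary_def chain_scale_def)

text \<open>Only edges at \<open>v\<close> are constrained. This local form is needed for chains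
  that are nonzero elsewhere outside \<open>A\<close>, as in the splitting of a disconnected
  subgraph.\<close>

lemma boundary_restrict:
  assumes "finite (arcs G)" "A \<subseteq> arcs G" "\<And>e. e \<in> arcs G - A \<Longrightarrow> (head G e = v \<or> tail G e = v) \<Longrightarrow> c e = 0"
  shows "boundary (edge_subgraph G A) c v = boundary G c v"
proof -
  have "(\<Sum>e\<in>in_arcs (edge_subgraph G A) v. c e) = (\<Sum>e\<in>in_arcs G v. c e)"
    using assms by (intro sum.mono_neutral_left) (auto simp: in_arcs_def edge_subgraph_def)
  moreover have "(\<Sum>e\<in>out_arcs (edge_subgraph G A) v. c e) = (\<Sum>e\<in>out_arcs G v. c e)"
    using assms by (intro sum.mono_neutral_left) (auto simp: out_arcs_def edge_subgraph_def)
  ultimately show ?thesis by (simp add: boundary_def)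
qed

text \<open>Links subgraphs with the linear algebra: cycles of a subgraph are the cycles of the
  whole graph supported on it.\<close>

lemma (in fin_digraph) H1_edge_subgraph:
  assumes "A \<subseteq> arcs G"
  shows "H1 (edge_subgraph G A) = vanishing (H1 G) (arcs G - A)"
proof -
  \<comment> \<open>The subgraph imposes no condition at vertices that \<open>A\<close> does not
    touch; there the boundary is an empty sum of contributions.\<close>
  have zero: "boundary G c v = 0"
    if "\<forall>e. e \<notin> A \<longrightarrow> c e = 0" "v \<notin> tail G ` A \<union> head G ` A" for c v
  proof -
    have "(\<Sum>e\<in>in_arcs G v. c e) = 0" "(\<Sum>e\<in>out_arcs G v. c e) = 0"
      using that by (auto intro!: sum.neutral)
    then show ?thesis by (simp add: boundary_def)
  qed
  have restrict: "boundary (edge_subgraph G A) c v = boundary G c v"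
    if "\<forall>e. e \<notin> A \<longrightarrow> c e = 0" for c v
    using assms that by (intro boundary_restrict) auto
  have verts: "verts (edge_subgraph G A) = tail G ` A \<union> head G ` A"
    and arcs: "arcs (edge_subgraph G A) = A"
    by (simp_all add: edge_subgraph_def)
  have sub: "tail G ` A \<union> head G ` A \<subseteq> verts G"
    using assms by auto
  show ?thesis
  proof (intro equalityI subsetI)
    fix c assume "c \<in> H1 (edge_subgraph G A)"
    then have off: "\<forall>e. e \<notin> A \<longrightarrow> c e = 0"
      and bd: "\<And>v. v \<in> tail G ` A \<union> head G ` A \<Longrightarrow> boundary (edge_subgraph G A) c v = 0"
      unfolding H1_def arcs verts by simp_all
    have "boundary G c v = 0" for v
      using zero[OF off, of v] bd[of v] restrict[OF off, of v] by argo
    then show "c \<in> vanishing (H1 G) (arcs G - A)"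
      using off assms by (auto simp: H1_def vanishing_def)
  next
    fix c assume c: "c \<in> vanishing (H1 G) (arcs G - A)"
    then have off: "\<forall>e. e \<notin> A \<longrightarrow> c e = 0"
      by (auto simp: H1_def vanishing_def)
    have "boundary G c v = 0" if "v \<in> tail G ` A \<union> head G ` A" for v
      using c sub that by (auto simp: H1_def vanishing_def)
    then show "c \<in> H1 (edge_subgraph G A)"
      using off unfolding H1_def arcs verts by (simp add: restrict[OF off])
  qed
qed

text \<open>A cycle on the union cuts into its restrictions to the two parts, which remain cycles
  because no vertex is shared. Only this inequality is needed for the induction on
  subgraphs.\<close>

lemma (in fin_digraph) loop_number_split:
  assumes A: "A1 \<subseteq> arcs G" "A2 \<subseteq> arcs G"
    and disj: "(tail G ` A1 \<union> head G ` A1) \<inter> (tail G ` A2 \<union> head G ` A2) = {}"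
    and fin: "finite S" "H1 G \<subseteq> chain.span S"
  shows "loop_number (edge_subgraph G (A1 \<union> A2))
    \<le> loop_number (edge_subgraph G A1) + loop_number (edge_subgraph G A2)"
proof -
  have basis: "\<exists>B. finite B \<and> H1 (edge_subgraph G A) \<subseteq> chain.span B \<and> card B = loop_number (edge_subgraph G A)"
    if "A \<subseteq> arcs G" for A
  proof -
    obtain B where B: "B \<subseteq> H1 (edge_subgraph G A)" "chain.independent B"
      "H1 (edge_subgraph G A) \<subseteq> chain.span B" "card B = chain.dim (H1 (edge_subgraph G A))"
      using chain.basis_exists by blast
    have "B \<subseteq> chain.span S"
      using B(1) fin(2) H1_edge_subgraph[OF that] by (auto simp: vanishing_def)
    then have "finite B" using chain.independent_span_bound[OF fin(1) B(2)] by blast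
    then show ?thesis using B by (auto simp: loop_number_def)
  qed
  obtain B1 where B1: "finite B1" "H1 (edge_subgraph G A1) \<subseteq> chain.span B1"
    "card B1 = loop_number (edge_subgraph G A1)" using basis[OF A(1)] by blast
  obtain B2 where B2: "finite B2" "H1 (edge_subgraph G A2) \<subseteq> chain.span B2"
    "card B2 = loop_number (edge_subgraph G A2)" using basis[OF A(2)] by blast
  \<comment> \<open>Stated for arbitrary \<open>A\<close> and \<open>A'\<close> so that it serves
    both parts. At a vertex of \<open>A\<close> no edge of \<open>A'\<close> ends, so the restricted
    chain has the same boundary there.\<close>
  have part: "(\<lambda>e. if e \<in> A then c e else 0) \<in> H1 (edge_subgraph G A)"
    if c: "c \<in> H1 (edge_subgraph G (A \<union> A'))" and A: "A \<union> A' \<subseteq> arcs G"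
      and disj: "(tail G ` A \<union> head G ` A) \<inter> (tail G ` A' \<union> head G ` A') = {}" for c A A'
  proof -
    have "boundary (edge_subgraph G A) (\<lambda>e. if e \<in> A then c e else 0) v = 0"
      if v: "v \<in> tail G ` A \<union> head G ` A" for v
    proof -
      have "boundary (edge_subgraph G A) (\<lambda>e. if e \<in> A then c e else 0) v = boundary (edge_subgraph G A) c v"
        unfolding boundary_def by (intro arg_cong2[where f = "(-)"] sum.cong) (auto simp: edge_subgraph_def)
      also have "\<dots> = boundary G c v"
      proof (rule boundary_restrict)
        show "c e = 0" if e: "e \<in> arcs G - A" "head G e = v \<or> tail G e = v" for e
        proof -
          have "e \<notin> A'" using e(2) v disj by blast
          then show ?thesis using c e(1) by (auto simp: H1_def edge_subgraph_def)
        qed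
      qed (use A in auto)
      also have "\<dots> = 0"
      proof -
        have "c \<in> H1 G" using c by (simp add: H1_edge_subgraph[OF A] vanishing_def)
        moreover have "v \<in> verts G" using v A by auto
        ultimately show ?thesis by (simp add: H1_def)
      qed
      finally show ?thesis .
    qed
    then show ?thesis by (auto simp: H1_def edge_subgraph_def)
  qed
  have "H1 (edge_subgraph G (A1 \<union> A2)) \<subseteq> chain.span (B1 \<union> B2)"
  proof
    fix c assume c: "c \<in> H1 (edge_subgraph G (A1 \<union> A2))"
    let ?c1 = "\<lambda>e. if e \<in> A1 then c e else 0" and ?c2 = "\<lambda>e. if e \<in> A2 then c e else 0"
    have "?c1 \<in> chain.span (B1 \<union> B2)"
      using part[OF c _ disj] A B1(2) chain.span_mono[of B1 "B1 \<union> B2"] by blast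
    moreover have "?c2 \<in> chain.span (B1 \<union> B2)"
      using part[of c A2 A1] c disj A B2(2) chain.span_mono[of B2 "B1 \<union> B2"]
      by (metis Int_commute Un_commute Un_least inf_sup_ord(3) subset_iff)
    ultimately have "?c1 + ?c2 \<in> chain.span (B1 \<union> B2)" by (rule chain.span_add)
    moreover have "?c1 + ?c2 = c"
    proof
      fix e
      have "\<not> (e \<in> A1 \<and> e \<in> A2)" using disj by blast
      then show "(?c1 + ?c2) e = c e"
        using c by (auto simp: H1_def edge_subgraph_def)
    qed
    ultimately show "c \<in> chain.span (B1 \<union> B2)" by simp
  qed
  then have "loop_number (edge_subgraph G (A1 \<union> A2)) \<le> card (B1 \<union> B2)"
    unfolding loop_number_def using B1(1) B2(1) by (intro chain.dim_le_card) auto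
  also have "\<dots> \<le> card B1 + card B2" by (rule card_Un_le)
  finally show ?thesis using B1(3) B2(3) by simp
qed

text \<open>Edges are sorted by whether they lie in the component of \<open>u\<close>. Every vertex
  of an edge subgraph is an end of some edge, so neither class is empty.\<close>

lemma (in fin_digraph) disconnected_split:
  assumes "A \<subseteq> arcs G" "A \<noteq> {}" "\<not> Digraph_Component.connected (edge_subgraph G A)"
  obtains A1 A2 where "A = A1 \<union> A2" "A1 \<noteq> {}" "A2 \<noteq> {}"
    "(tail G ` A1 \<union> head G ` A1) \<inter> (tail G ` A2 \<union> head G ` A2) = {}"
proof -
  define V where "V = tail G ` A \<union> head G ` A"
  \<comment> \<open>Both directions of every edge are included, so that reachability ignores the
    orientation.\<close>
  define r where "r = (\<Union>e\<in>A. {(tail G e, head G e), (head G e, tail G e)})"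
  have "V \<noteq> {}" using assms(2) by (auto simp: V_def)
  then obtain u v where uv: "u \<in> V" "v \<in> V" "(u, v) \<notin> rtrancl_on V r"
    using assms(3)
    by (auto simp: Digraph_Component.connected_def strongly_connected_def reachable_def
        parcs_mk_symmetric edge_subgraph_def V_def r_def)
  define R where "R = {w. (u, w) \<in> rtrancl_on V r}"
  have R: "w' \<in> R" if "w \<in> R" "(w, w') \<in> r" for w w'
  proof -
    have "w' \<in> V" using that(2) by (auto simp: r_def V_def)
    then show ?thesis using that rtrancl_on_into_rtrancl_on[of u w V r w'] by (simp add: R_def)
  qed
  have iff: "tail G e \<in> R \<longleftrightarrow> head G e \<in> R" if "e \<in> A" for e
    using R[of "tail G e" "head G e"] R[of "head G e" "tail G e"] that by (auto simp: r_def)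
  have "u \<in> R" using uv(1) by (simp add: R_def)
  have "v \<notin> R" using uv(3) by (simp add: R_def)
  show ?thesis
  proof (rule that[of "{e \<in> A. tail G e \<in> R}" "{e \<in> A. tail G e \<notin> R}"])
    show "{e \<in> A. tail G e \<in> R} \<noteq> {}"
      using uv(1) \<open>u \<in> R\<close> iff by (auto simp: V_def)
    show "{e \<in> A. tail G e \<notin> R} \<noteq> {}"
      using uv(2) \<open>v \<notin> R\<close> iff by (auto simp: V_def)
    show "(tail G ` {e \<in> A. tail G e \<in> R} \<union> head G ` {e \<in> A. tail G e \<in> R}) \<inter>
      (tail G ` {e \<in> A. tail G e \<notin> R} \<union> head G ` {e \<in> A. tail G e \<notin> R}) = {}"
      using iff by auto
  qed auto
qed

text \<open>A disconnected subgraph splits into two smaller ones; edge numbers add and loop numbers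
  are subadditive, so the strict inequalities add up.\<close>

lemma (in fin_digraph) convergent_if_connected_convergent:
  assumes fin: "finite S" "H1 G \<subseteq> chain.span S"
    and conn: "\<And>A. A \<noteq> {} \<Longrightarrow> A \<subset> arcs G \<Longrightarrow> Digraph_Component.connected (edge_subgraph G A)
      \<Longrightarrow> convergent_graph (edge_subgraph G A)"
    and A: "A \<noteq> {}" "A \<subset> arcs G"
  shows "convergent_graph (edge_subgraph G A)"
  using A
proof (induction "card A" arbitrary: A rule: less_induct)
  case less
  show ?case
  proof (cases "Digraph_Component.connected (edge_subgraph G A)")
    case True
    then show ?thesis using conn less.prems by blast
  next
    case False
    have sub: "A \<subseteq> arcs G" using less.prems by blast
    obtain A1 A2 where A12: "A = A1 \<union> A2" "A1 \<noteq> {}" "A2 \<noteq> {}"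
      "(tail G ` A1 \<union> head G ` A1) \<inter> (tail G ` A2 \<union> head G ` A2) = {}"
      using disconnected_split[OF sub less.prems(1) False] by metis
    have finA: "finite A1" "finite A2"
      using A12(1) sub finite_arcs by (meson Un_least finite_subset le_sup_iff)+
    have "A1 \<inter> A2 = {}" using A12(4) by blast
    then have card: "card A = card A1 + card A2" using A12(1) finA by (simp add: card_Un_disjoint)
    have pos: "card A1 > 0" "card A2 > 0" using A12 finA by (simp_all add: card_gt_0_iff)
    have "convergent_graph (edge_subgraph G A1)" "convergent_graph (edge_subgraph G A2)"
      using less.prems A12 card pos by (auto intro!: less.hyps)
    moreover have "loop_number (edge_subgraph G A) \<le>
      loop_number (edge_subgraph G A1) + loop_number (edge_subgraph G A2)"
      unfolding A12(1) using sub A12 fin by (intro loop_number_split) auto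
    ultimately show ?thesis using card by (simp add: convergent_graph_def edge_subgraph_def)
  qed
qed

section \<open>The projective form in the chart, and the equivalence\<close>

lemma Omega_chart:
  assumes "N \<ge> 1"
  shows "Omega N (x(1 := 1)) (\<lambda>c k. if k = c + 2 then 1 else 0) = -1"
proof -
  let ?v = "\<lambda>c k. if k = c + 2 then 1 else 0 :: real"
  have range: "[1..<Suc N] = 1 # [2..<Suc N]"
    using assms by (simp add: upt_conv_Cons numeral_2_eq_2)
  have w1: "wedge_dZ (filter (\<lambda>k. k \<noteq> 1) [1..<Suc N]) ?v = 1"
  proof -
    have "filter (\<lambda>k. k \<noteq> 1) [1..<Suc N] = [2..<Suc N]"
      unfolding range by (auto simp: filter_id_conv)
    \<comment> \<open>The offset 2 in the tangent vectors matches the first index of the list, so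
      the matrix is the identity.\<close>
    moreover have "Matrix.mat (N - 1) (N - 1) (\<lambda>(r, c). ?v c ([2..<Suc N] ! r)) = 1\<^sub>m (N - 1)"
      by (rule eq_matI) (auto simp del: upt_Suc)
    moreover have "length [2..<Suc N] = N - 1" by (simp del: upt_Suc)
    ultimately show ?thesis by (simp only: wedge_dZ_def det_one)
  qed
  \<comment> \<open>For \<open>i\<close> other than 1 the wedge contains the differential of the
    first coordinate, which is constant on the chart; this gives a zero row.\<close>
  have wi: "wedge_dZ (filter (\<lambda>k. k \<noteq> i) [1..<Suc N]) ?v = 0" if "i \<noteq> 1" for i
  proof -
    define ks where "ks = filter (\<lambda>k. k \<noteq> i) [1..<Suc N]"
    have ks: "ks = 1 # filter (\<lambda>k. k \<noteq> i) [2..<Suc N]"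
      using that unfolding ks_def range by (simp del: upt_Suc)
    let ?M = "Matrix.mat (length ks) (length ks) (\<lambda>(r, c). ?v c (ks ! r))"
    have len: "0 < length ks" by (simp add: ks)
    have "?M $$ (0, j) = 0" if "j < length ks" for j
      using that len by (simp add: ks)
    then have "Determinant.det ?M = 0"
      using len by (subst laplace_expansion_row[of _ "length ks" 0]) auto
    then show ?thesis unfolding wedge_dZ_def ks_def .
  qed
  have "Omega N (x(1 := 1)) ?v = (\<Sum>i\<in>{1}. (-1) ^ i * (x(1 := 1)) i * wedge_dZ (filter (\<lambda>k. k \<noteq> i) [1..<Suc N]) ?v)"
    unfolding Omega_def using assms wi by (intro sum.mono_neutral_right) auto
  then show ?thesis using w1 by simp
qed

lemma (in cycle_coordinates) period_eq_chart:
  assumes "arcs G = E"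
  shows "period G (4 * n) B = (\<integral>\<^sup>+x. integrand (x(1 := 1)) \<partial>lborelP {2..4*n})"
proof -
  have "feynman_quadric e (real_point (4 * n) B Z) = quad e Z" for e Z
    by (simp add: feynman_quadric_def edge_functional_def coord_real_point quad_def)
  moreover have "Omega (4 * n) (x(1 := 1)) (\<lambda>c k. if k = c + 2 then 1 else 0) = -1" for x
    using n by (intro Omega_chart) simp
  ultimately show ?thesis
    unfolding period_def proj_integral_def by (simp add: integrand_def assms)
qed

theorem proposition5p2:
  fixes \<Gamma> :: "('v, 'e) pre_digraph"
    and n :: nat
    and B :: "nat \<Rightarrow> 4 \<Rightarrow> 'e \<Rightarrow> rat"
  assumes "fin_digraph \<Gamma>"
    and "Digraph_Component.connected \<Gamma>"
    and "log_divergent \<Gamma>"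
    and "loop_number \<Gamma> = n"
    and "n \<ge> 1"
    and "card (arcs \<Gamma>) = 2 * n"
    and "linear_coordinates \<Gamma> (4 * n) B"
  shows "(period_converges \<Gamma> (4 * n) B \<longleftrightarrow>
            (\<forall>A. A \<noteq> {} \<and> A \<subset> arcs \<Gamma> \<longrightarrow> convergent_graph (edge_subgraph \<Gamma> A)))
       \<and> (period_converges \<Gamma> (4 * n) B \<longleftrightarrow> primitive_log_divergent \<Gamma>)"
proof -
  interpret fin_digraph \<Gamma> by fact
  interpret cycle_coordinates "arcs \<Gamma>" "H1 \<Gamma>" n B
  proof
    show "c e = 0" if "c \<in> H1 \<Gamma>" "e \<notin> arcs \<Gamma>" for c e
      using that by (simp add: H1_def)
  qed (use assms subspace_H1 in \<open>simp_all add: loop_number_def linear_coordinates_def H1_4_def\<close>)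
  have conv: "period_converges \<Gamma> (4 * n) B \<longleftrightarrow> primitive_rank"
    unfolding period_converges_def period_eq_chart[OF refl]
  proof
    assume fin: "(\<integral>\<^sup>+x. integrand (x(1 := 1)) \<partial>lborelP {2..4*n}) < \<infinity>"
    show primitive_rank
      unfolding primitive_rank_def
    proof (intro allI impI)
      fix F assume "F \<noteq> {}" "F \<subset> arcs \<Gamma>"
      from chart_infinite[OF this] fin
      show "card F + 2 * chain.dim (vanishing (H1 \<Gamma>) F) < 2 * n"
        by (cases "2 * n \<le> card F + 2 * chain.dim (vanishing (H1 \<Gamma>) F)") simp_all
    qed
  qed (rule chart_finite)
  \<comment> \<open>Deleting \<open>F\<close> leaves \<open>2 * n - card F\<close> edges, and the
    loop number of what remains is the dimension of the vanishing space.\<close>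
  have convergent_iff: "convergent_graph (edge_subgraph \<Gamma> (arcs \<Gamma> - F)) \<longleftrightarrow>
      card F + 2 * chain.dim (vanishing (H1 \<Gamma>) F) < 2 * n" if "F \<subseteq> arcs \<Gamma>" for F
  proof -
    have "arcs \<Gamma> - (arcs \<Gamma> - F) = F" using that by blast
    moreover have "card (arcs \<Gamma> - F) = 2 * n - card F" "card F \<le> 2 * n"
      using card_Diff_subset[OF finite_subset[OF that finite_E] that] card_mono[OF finite_E that]
      by (simp_all only: card_E)
    ultimately show ?thesis
      by (auto simp: convergent_graph_def loop_number_def H1_edge_subgraph) (auto simp: edge_subgraph_def)
  qed
  have rank: "primitive_rank \<longleftrightarrow>
    (\<forall>A. A \<noteq> {} \<and> A \<subset> arcs \<Gamma> \<longrightarrow> convergent_graph (edge_subgraph \<Gamma> A))"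
  proof
    assume prim: "primitive_rank"
    show "\<forall>A. A \<noteq> {} \<and> A \<subset> arcs \<Gamma> \<longrightarrow> convergent_graph (edge_subgraph \<Gamma> A)"
    proof (intro allI impI)
      fix A assume A: "A \<noteq> {} \<and> A \<subset> arcs \<Gamma>"
      then have F: "arcs \<Gamma> - A \<noteq> {}" "arcs \<Gamma> - A \<subset> arcs \<Gamma>" "arcs \<Gamma> - (arcs \<Gamma> - A) = A"
        by blast+
      have "convergent_graph (edge_subgraph \<Gamma> (arcs \<Gamma> - (arcs \<Gamma> - A)))"
        unfolding convergent_iff[OF Diff_subset]
        using prim F(1,2) unfolding primitive_rank_def by simp
      then show "convergent_graph (edge_subgraph \<Gamma> A)" by (simp only: F(3))
    qed
  next
    assume conv: "\<forall>A. A \<noteq> {} \<and> A \<subset> arcs \<Gamma> \<longrightarrow> convergent_graph (edge_subgraph \<Gamma> A)"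
    show "primitive_rank"
      unfolding primitive_rank_def
    proof (intro allI impI)
      fix F assume F: "F \<noteq> {}" "F \<subset> arcs \<Gamma>"
      then have "arcs \<Gamma> - F \<noteq> {} \<and> arcs \<Gamma> - F \<subset> arcs \<Gamma>" by blast
      with conv have "convergent_graph (edge_subgraph \<Gamma> (arcs \<Gamma> - F))" by simp
      then show "card F + 2 * chain.dim (vanishing (H1 \<Gamma>) F) < 2 * n"
        using convergent_iff[OF psubset_imp_subset[OF F(2)]] by simp
    qed
  qed
  \<comment> \<open>Primitivity tests only connected subgraphs; the splitting argument extends it to
    all nonempty proper ones.\<close>
  have prim: "primitive_log_divergent \<Gamma> \<longleftrightarrow>
    (\<forall>A. A \<noteq> {} \<and> A \<subset> arcs \<Gamma> \<longrightarrow> convergent_graph (edge_subgraph \<Gamma> A))"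
  proof -
    obtain S where S: "finite S" "H1 \<Gamma> \<subseteq> chain.span S" using finite_dimensional by blast
    show ?thesis
    proof
      assume prim: "primitive_log_divergent \<Gamma>"
      show "\<forall>A. A \<noteq> {} \<and> A \<subset> arcs \<Gamma> \<longrightarrow> convergent_graph (edge_subgraph \<Gamma> A)"
      proof (intro allI impI, elim conjE)
        fix A assume A: "A \<noteq> {}" "A \<subset> arcs \<Gamma>"
        show "convergent_graph (edge_subgraph \<Gamma> A)"
          by (rule convergent_if_connected_convergent[OF S _ A])
            (use prim in \<open>simp add: primitive_log_divergent_def\<close>)
      qed
    next
      assume "\<forall>A. A \<noteq> {} \<and> A \<subset> arcs \<Gamma> \<longrightarrow> convergent_graph (edge_subgraph \<Gamma> A)"
      then show "primitive_log_divergent \<Gamma>"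
        using assms(2,3) by (simp add: primitive_log_divergent_def)
    qed
  qed
  show ?thesis unfolding conv prim rank by simp
qed

end
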